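(* Let $H$ be a cocommutative Hopf algebra. Set $X:=H\otimes H$, with the comultiplication $\Delta_X(x\otimes y)=(x^{(1)}\otimes y^{(1)})\otimes(x^{(2)}\otimes y^{(2)})$, define $\nu:X\to H$ by $\nu(x\otimes y):=S(x)y$, and define the right action of $H$ on $X$ by $(x\otimes y)\cdot g:=(x\otimes y)\Delta_H(g)=(xg^{(1)})\otimes(yg^{(2)})$. Then the R-matrix associated to $\nu$, i.e. the linear map $R:X\otimes X\to X\otimes X$ given by $R(u\otimes v)=v^{(1)}\otimes\bigl(u\cdot\nu(v^{(2)})\bigr)$ for $u,v\in X$ (where $\Delta_X(v)=v^{(1)}\otimes v^{(2)}$), is a solution to the Yang-Baxter equation $$(R\otimes\mathbb{1})(\mathbb{1}\otimes R)(R\otimes\mathbb{1})=(\mathbb{1}\otimes R)(R\otimes\mathbb{1})(\mathbb{1}\otimes R).$$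
   Context: Everything is over a commutative unital ring $\mathbb{k}$; tensor products are over $\mathbb{k}$ and $\mathbb{1}$ is the identity map. A Hopf algebra $H$ has multiplication (written as juxtaposition), unit, comultiplication $\Delta_H$, counit and antipode $S$. Sweedler notation $\Delta(x)=x^{(1)}\otimes x^{(2)}$ is used with summation suppressed. *)

theory Defs
  imports "HOL-Algebra.Module" "HOL-Algebra.AbelCoset"
begin

definition base_module :: "('k, 'm) ring_scheme \<Rightarrow> ('k, 'k) module" where
  "base_module K = \<lparr>carrier = carrier K, monoid.mult = monoid.mult K, one = one K,
     zero = zero K, add = add K, smult = monoid.mult K\<rparr>"

definition linear_maps ::
  "('k, 'm) ring_scheme \<Rightarrow> ('k, 'a, 'n) module_scheme \<Rightarrow> ('k, 'b, 'p) module_scheme \<Rightarrow> ('a \<Rightarrow> 'b) set"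
  where
  "linear_maps K M N = {f. f \<in> carrier M \<rightarrow> carrier N \<and>
     (\<forall>x\<in>carrier M. \<forall>y\<in>carrier M. f (x \<oplus>\<^bsub>M\<^esub> y) = f x \<oplus>\<^bsub>N\<^esub> f y) \<and>
     (\<forall>a\<in>carrier K. \<forall>x\<in>carrier M. f (a \<odot>\<^bsub>M\<^esub> x) = a \<odot>\<^bsub>N\<^esub> f x)}"

text \<open>The fields \<open>mult\<close> and \<open>one\<close> come with the record type \<open>module\<close>. They play no role in
  \<open>free_module\<close> and \<open>tensor_module\<close> and are left unspecified there.\<close>

definition free_module :: "('k, 'm) ring_scheme \<Rightarrow> 's set \<Rightarrow> ('k, 's \<Rightarrow> 'k) module" where
  "free_module K B = \<lparr>carrier = {f. (\<forall>s. f s \<in> carrier K) \<and> {s. f s \<noteq> \<zero>\<^bsub>K\<^esub>} \<subseteq> B \<and> finite {s. f s \<noteq> \<zero>\<^bsub>K\<^esub>}},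
     monoid.mult = undefined, one = undefined,
     zero = (\<lambda>s. \<zero>\<^bsub>K\<^esub>), add = (\<lambda>f g s. f s \<oplus>\<^bsub>K\<^esub> g s), smult = (\<lambda>a f s. a \<otimes>\<^bsub>K\<^esub> f s)\<rparr>"

definition free_gen :: "('k, 'm) ring_scheme \<Rightarrow> 's \<Rightarrow> 's \<Rightarrow> 'k" where
  "free_gen K s = (\<lambda>t. if t = s then \<one>\<^bsub>K\<^esub> else \<zero>\<^bsub>K\<^esub>)"

definition bilinear_relations ::
  "('k, 'm) ring_scheme \<Rightarrow> ('k, 'a, 'n) module_scheme \<Rightarrow> ('k, 'b, 'p) module_scheme \<Rightarrow> ('a \<times> 'b \<Rightarrow> 'k) set"
  where
  "bilinear_relations K M N = (let F = free_module K (carrier M \<times> carrier N); \<delta> = free_gen K in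
     {\<delta> (x \<oplus>\<^bsub>M\<^esub> x', y) \<ominus>\<^bsub>F\<^esub> (\<delta> (x, y) \<oplus>\<^bsub>F\<^esub> \<delta> (x', y)) | x x' y.
        x \<in> carrier M \<and> x' \<in> carrier M \<and> y \<in> carrier N} \<union>
     {\<delta> (x, y \<oplus>\<^bsub>N\<^esub> y') \<ominus>\<^bsub>F\<^esub> (\<delta> (x, y) \<oplus>\<^bsub>F\<^esub> \<delta> (x, y')) | x y y'.
        x \<in> carrier M \<and> y \<in> carrier N \<and> y' \<in> carrier N} \<union>
     {\<delta> (a \<odot>\<^bsub>M\<^esub> x, y) \<ominus>\<^bsub>F\<^esub> (a \<odot>\<^bsub>F\<^esub> \<delta> (x, y)) | a x y.
        a \<in> carrier K \<and> x \<in> carrier M \<and> y \<in> carrier N} \<union>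
     {\<delta> (x, a \<odot>\<^bsub>N\<^esub> y) \<ominus>\<^bsub>F\<^esub> (a \<odot>\<^bsub>F\<^esub> \<delta> (x, y)) | a x y.
        a \<in> carrier K \<and> x \<in> carrier M \<and> y \<in> carrier N})"

definition tensor_kernel ::
  "('k, 'm) ring_scheme \<Rightarrow> ('k, 'a, 'n) module_scheme \<Rightarrow> ('k, 'b, 'p) module_scheme \<Rightarrow> ('a \<times> 'b \<Rightarrow> 'k) set"
  where
  "tensor_kernel K M N =
     \<Inter>{U. submodule U K (free_module K (carrier M \<times> carrier N)) \<and> bilinear_relations K M N \<subseteq> U}"

text \<open>The tensor product is the quotient of the free module on \<open>carrier M \<times> carrier N\<close> by the
  bilinearity relations; its elements are cosets.\<close>

definition tensor_module ::
  "('k, 'm) ring_scheme \<Rightarrow> ('k, 'a, 'n) module_scheme \<Rightarrow> ('k, 'b, 'p) module_scheme \<Rightarrow>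
   ('k, ('a \<times> 'b \<Rightarrow> 'k) set) module"
  where
  "tensor_module K M N = (let F = free_module K (carrier M \<times> carrier N); U = tensor_kernel K M N in
     \<lparr>carrier = a_rcosets\<^bsub>F\<^esub> U, monoid.mult = undefined, one = undefined,
      zero = U, add = (\<lambda>s t. s <+>\<^bsub>F\<^esub> t), smult = (\<lambda>a t. \<Union>f\<in>t. U +>\<^bsub>F\<^esub> (a \<odot>\<^bsub>F\<^esub> f))\<rparr>)"

definition pure_tensor ::
  "('k, 'm) ring_scheme \<Rightarrow> ('k, 'a, 'n) module_scheme \<Rightarrow> ('k, 'b, 'p) module_scheme \<Rightarrow>
   'a \<Rightarrow> 'b \<Rightarrow> ('a \<times> 'b \<Rightarrow> 'k) set"
  where
  "pure_tensor K M N x y =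
     tensor_kernel K M N +>\<^bsub>free_module K (carrier M \<times> carrier N)\<^esub> free_gen K (x, y)"

text \<open>For a bilinear map \<open>\<phi>\<close> on \<open>M \<times> N\<close> with values in \<open>P\<close>, \<open>tensor_lift K M N P \<phi>\<close> is the linear map
  on \<open>M \<otimes> N\<close> with \<open>x \<otimes> y \<mapsto> \<phi> x y\<close>; for bilinear \<open>\<phi>\<close> the value does not depend on the
  chosen representative \<open>f\<close> of the coset \<open>t\<close>. Sweedler notation is rendered by it:
  \<open>tensor_lift K C C P \<phi> (\<Delta> x)\<close> is \<open>\<phi> x\<^sup>(\<^sup>1\<^sup>) x\<^sup>(\<^sup>2\<^sup>)\<close>.\<close>

definition tensor_lift ::
  "('k, 'm) ring_scheme \<Rightarrow> ('k, 'a, 'n) module_scheme \<Rightarrow> ('k, 'b, 'p) module_scheme \<Rightarrow>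
   ('k, 'c, 'q) module_scheme \<Rightarrow> ('a \<Rightarrow> 'b \<Rightarrow> 'c) \<Rightarrow> ('a \<times> 'b \<Rightarrow> 'k) set \<Rightarrow> 'c"
  where
  "tensor_lift K M N P \<phi> t = (let f = (SOME f. f \<in> t) in
     \<Oplus>\<^bsub>P\<^esub>s\<in>{s. f s \<noteq> \<zero>\<^bsub>K\<^esub>}. f s \<odot>\<^bsub>P\<^esub> \<phi> (fst s) (snd s))"

definition tensor_map ::
  "('k, 'm) ring_scheme \<Rightarrow> ('k, 'a, 'n) module_scheme \<Rightarrow> ('k, 'b, 'p) module_scheme \<Rightarrow>
   ('k, 'c, 'q) module_scheme \<Rightarrow> ('k, 'd, 'r) module_scheme \<Rightarrow> ('a \<Rightarrow> 'c) \<Rightarrow> ('b \<Rightarrow> 'd) \<Rightarrow>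
   ('a \<times> 'b \<Rightarrow> 'k) set \<Rightarrow> ('c \<times> 'd \<Rightarrow> 'k) set"
  where
  "tensor_map K M N M' N' f g =
     tensor_lift K M N (tensor_module K M' N') (\<lambda>x y. pure_tensor K M' N' (f x) (g y))"

definition tensor_swap ::
  "('k, 'm) ring_scheme \<Rightarrow> ('k, 'a, 'n) module_scheme \<Rightarrow> ('k, 'b, 'p) module_scheme \<Rightarrow>
   ('a \<times> 'b \<Rightarrow> 'k) set \<Rightarrow> ('b \<times> 'a \<Rightarrow> 'k) set"
  where
  "tensor_swap K M N = tensor_lift K M N (tensor_module K N M) (\<lambda>x y. pure_tensor K N M y x)"

text \<open>\<open>tensor_assoc\<close> and \<open>tensor_unassoc\<close> are the mutually inverse canonical maps between
  \<open>(L \<otimes> M) \<otimes> N\<close> and \<open>L \<otimes> (M \<otimes> N)\<close>.\<close>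

definition tensor_assoc ::
  "('k, 'm) ring_scheme \<Rightarrow> ('k, 'a, 'n) module_scheme \<Rightarrow> ('k, 'b, 'p) module_scheme \<Rightarrow>
   ('k, 'c, 'q) module_scheme \<Rightarrow> (('a \<times> 'b \<Rightarrow> 'k) set \<times> 'c \<Rightarrow> 'k) set \<Rightarrow>
   ('a \<times> ('b \<times> 'c \<Rightarrow> 'k) set \<Rightarrow> 'k) set"
  where
  "tensor_assoc K L M N =
    (let P = tensor_module K L (tensor_module K M N) in
     tensor_lift K (tensor_module K L M) N P
      (\<lambda>t z. tensor_lift K L M P
        (\<lambda>x y. pure_tensor K L (tensor_module K M N) x (pure_tensor K M N y z)) t))"

definition tensor_unassoc ::
  "('k, 'm) ring_scheme \<Rightarrow> ('k, 'a, 'n) module_scheme \<Rightarrow> ('k, 'b, 'p) module_scheme \<Rightarrow>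
   ('k, 'c, 'q) module_scheme \<Rightarrow> ('a \<times> ('b \<times> 'c \<Rightarrow> 'k) set \<Rightarrow> 'k) set \<Rightarrow>
   (('a \<times> 'b \<Rightarrow> 'k) set \<times> 'c \<Rightarrow> 'k) set"
  where
  "tensor_unassoc K L M N =
    (let P = tensor_module K (tensor_module K L M) N in
     tensor_lift K L (tensor_module K M N) P
      (\<lambda>x t. tensor_lift K M N P
        (\<lambda>y z. pure_tensor K (tensor_module K L M) N (pure_tensor K L M x y) z) t))"

text \<open>For algebras \<open>A\<close> and \<open>B\<close>, \<open>tensor_algebra K A B\<close> is \<open>A \<otimes> B\<close> with the product
  \<open>(a \<otimes> b) (a' \<otimes> b') = a a' \<otimes> b b'\<close>.\<close>

definition tensor_algebra ::
  "('k, 'm) ring_scheme \<Rightarrow> ('k, 'a, 'n) module_scheme \<Rightarrow> ('k, 'b, 'p) module_scheme \<Rightarrow>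
   ('k, ('a \<times> 'b \<Rightarrow> 'k) set) module"
  where
  "tensor_algebra K A B = (let T = tensor_module K A B in
     T\<lparr>monoid.mult := (\<lambda>s t. tensor_lift K A B T (\<lambda>a b. tensor_lift K A B T
          (\<lambda>a' b'. pure_tensor K A B (a \<otimes>\<^bsub>A\<^esub> a') (b \<otimes>\<^bsub>B\<^esub> b')) t) s),
       one := pure_tensor K A B \<one>\<^bsub>A\<^esub> \<one>\<^bsub>B\<^esub>\<rparr>)"

text \<open>Associative and unital, not necessarily commutative (unlike the locale \<open>algebra\<close> of
  HOL-Algebra).\<close>

locale unital_algebra = module K A + ring A
  for K :: "('k, 'm) ring_scheme" and A :: "('k, 'a, 'n) module_scheme" +
  assumes smult_mult_left: "\<lbrakk>a \<in> carrier K; x \<in> carrier A; y \<in> carrier A\<rbrakk> \<Longrightarrow>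
      (a \<odot>\<^bsub>A\<^esub> x) \<otimes>\<^bsub>A\<^esub> y = a \<odot>\<^bsub>A\<^esub> (x \<otimes>\<^bsub>A\<^esub> y)"
    and smult_mult_right: "\<lbrakk>a \<in> carrier K; x \<in> carrier A; y \<in> carrier A\<rbrakk> \<Longrightarrow>
      x \<otimes>\<^bsub>A\<^esub> (a \<odot>\<^bsub>A\<^esub> y) = a \<odot>\<^bsub>A\<^esub> (x \<otimes>\<^bsub>A\<^esub> y)"

locale coalgebra = module K C
  for K :: "('k, 'm) ring_scheme" and C :: "('k, 'a, 'n) module_scheme" +
  fixes \<Delta> :: "'a \<Rightarrow> ('a \<times> 'a \<Rightarrow> 'k) set" and \<epsilon> :: "'a \<Rightarrow> 'k"
  assumes comult_linear: "\<Delta> \<in> linear_maps K C (tensor_module K C C)"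
    and counit_linear: "\<epsilon> \<in> linear_maps K C (base_module K)"
    and coassoc: "x \<in> carrier C \<Longrightarrow>
      tensor_assoc K C C C (tensor_map K C C (tensor_module K C C) C \<Delta> id (\<Delta> x)) =
      tensor_map K C C C (tensor_module K C C) id \<Delta> (\<Delta> x)"
    and counit_left: "x \<in> carrier C \<Longrightarrow> tensor_lift K C C C (\<lambda>y z. \<epsilon> y \<odot>\<^bsub>C\<^esub> z) (\<Delta> x) = x"
    and counit_right: "x \<in> carrier C \<Longrightarrow> tensor_lift K C C C (\<lambda>y z. \<epsilon> z \<odot>\<^bsub>C\<^esub> y) (\<Delta> x) = x"

locale bialgebra = unital_algebra K H + coalgebra K H \<Delta> \<epsilon>
  for K :: "('k, 'm) ring_scheme" and H :: "('k, 'a, 'n) module_scheme"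
    and \<Delta> :: "'a \<Rightarrow> ('a \<times> 'a \<Rightarrow> 'k) set" and \<epsilon> :: "'a \<Rightarrow> 'k" +
  assumes comult_mult: "\<lbrakk>x \<in> carrier H; y \<in> carrier H\<rbrakk> \<Longrightarrow>
      \<Delta> (x \<otimes>\<^bsub>H\<^esub> y) = \<Delta> x \<otimes>\<^bsub>tensor_algebra K H H\<^esub> \<Delta> y"
    and comult_one: "\<Delta> \<one>\<^bsub>H\<^esub> = \<one>\<^bsub>tensor_algebra K H H\<^esub>"
    and counit_mult: "\<lbrakk>x \<in> carrier H; y \<in> carrier H\<rbrakk> \<Longrightarrow> \<epsilon> (x \<otimes>\<^bsub>H\<^esub> y) = \<epsilon> x \<otimes>\<^bsub>K\<^esub> \<epsilon> y"
    and counit_one: "\<epsilon> \<one>\<^bsub>H\<^esub> = \<one>\<^bsub>K\<^esub>"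

locale hopf_algebra = bialgebra K H \<Delta> \<epsilon>
  for K :: "('k, 'm) ring_scheme" and H :: "('k, 'a, 'n) module_scheme"
    and \<Delta> :: "'a \<Rightarrow> ('a \<times> 'a \<Rightarrow> 'k) set" and \<epsilon> :: "'a \<Rightarrow> 'k" +
  fixes S :: "'a \<Rightarrow> 'a"
  assumes antipode_linear: "S \<in> linear_maps K H H"
    and antipode_left: "x \<in> carrier H \<Longrightarrow>
      tensor_lift K H H H (\<lambda>y z. S y \<otimes>\<^bsub>H\<^esub> z) (\<Delta> x) = \<epsilon> x \<odot>\<^bsub>H\<^esub> \<one>\<^bsub>H\<^esub>"
    and antipode_right: "x \<in> carrier H \<Longrightarrow>
      tensor_lift K H H H (\<lambda>y z. y \<otimes>\<^bsub>H\<^esub> S z) (\<Delta> x) = \<epsilon> x \<odot>\<^bsub>H\<^esub> \<one>\<^bsub>H\<^esub>"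

locale cocommutative_hopf_algebra = hopf_algebra K H \<Delta> \<epsilon> S
  for K :: "('k, 'm) ring_scheme" and H :: "('k, 'a, 'n) module_scheme"
    and \<Delta> :: "'a \<Rightarrow> ('a \<times> 'a \<Rightarrow> 'k) set" and \<epsilon> :: "'a \<Rightarrow> 'k" and S :: "'a \<Rightarrow> 'a" +
  assumes cocommutative: "x \<in> carrier H \<Longrightarrow> tensor_swap K H H (\<Delta> x) = \<Delta> x"

text \<open>\<open>x \<otimes> y \<mapsto> (x\<^sup>(\<^sup>1\<^sup>) \<otimes> y\<^sup>(\<^sup>1\<^sup>)) \<otimes> (x\<^sup>(\<^sup>2\<^sup>) \<otimes> y\<^sup>(\<^sup>2\<^sup>))\<close>\<close>

definition tensor_comult ::
  "('k, 'm) ring_scheme \<Rightarrow> ('k, 'a, 'n) module_scheme \<Rightarrow> ('a \<Rightarrow> ('a \<times> 'a \<Rightarrow> 'k) set) \<Rightarrow>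
   ('k, 'b, 'p) module_scheme \<Rightarrow> ('b \<Rightarrow> ('b \<times> 'b \<Rightarrow> 'k) set) \<Rightarrow>
   ('a \<times> 'b \<Rightarrow> 'k) set \<Rightarrow> (('a \<times> 'b \<Rightarrow> 'k) set \<times> ('a \<times> 'b \<Rightarrow> 'k) set \<Rightarrow> 'k) set"
  where
  "tensor_comult K C \<Delta>\<^sub>C D \<Delta>\<^sub>D =
    (let X = tensor_module K C D; XX = tensor_module K X X in
     tensor_lift K C D XX (\<lambda>x y.
       tensor_lift K C C XX (\<lambda>x\<^sub>1 x\<^sub>2.
         tensor_lift K D D XX (\<lambda>y\<^sub>1 y\<^sub>2.
           pure_tensor K X X (pure_tensor K C D x\<^sub>1 y\<^sub>1) (pure_tensor K C D x\<^sub>2 y\<^sub>2))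
         (\<Delta>\<^sub>D y))
       (\<Delta>\<^sub>C x)))"

text \<open>\<open>u \<otimes> v \<mapsto> v\<^sup>(\<^sup>1\<^sup>) \<otimes> (u \<cdot> \<nu> v\<^sup>(\<^sup>2\<^sup>))\<close>, where \<open>act u g\<close> is \<open>u \<cdot> g\<close>\<close>

definition R_matrix ::
  "('k, 'm) ring_scheme \<Rightarrow> ('k, 'a, 'n) module_scheme \<Rightarrow> ('a \<Rightarrow> ('a \<times> 'a \<Rightarrow> 'k) set) \<Rightarrow>
   ('a \<Rightarrow> 'h \<Rightarrow> 'a) \<Rightarrow> ('a \<Rightarrow> 'h) \<Rightarrow> ('a \<times> 'a \<Rightarrow> 'k) set \<Rightarrow> ('a \<times> 'a \<Rightarrow> 'k) set"
  where
  "R_matrix K X \<Delta>\<^sub>X act \<nu> =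
    (let XX = tensor_module K X X in
     tensor_lift K X X XX (\<lambda>u v.
       tensor_lift K X X XX (\<lambda>v\<^sub>1 v\<^sub>2. pure_tensor K X X v\<^sub>1 (act u (\<nu> v\<^sub>2))) (\<Delta>\<^sub>X v)))"

text \<open>Both sides of the equation are endomorphisms of \<open>(X \<otimes> X) \<otimes> X\<close>; the map \<open>1 \<otimes> R\<close> on
  \<open>X \<otimes> (X \<otimes> X)\<close> is transported along the associativity isomorphism.\<close>

definition yang_baxter_solution ::
  "('k, 'm) ring_scheme \<Rightarrow> ('k, 'a, 'n) module_scheme \<Rightarrow>
   (('a \<times> 'a \<Rightarrow> 'k) set \<Rightarrow> ('a \<times> 'a \<Rightarrow> 'k) set) \<Rightarrow> bool"
  where
  "yang_baxter_solution K X R \<longleftrightarrow>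
    (let XX = tensor_module K X X;
         R_I = tensor_map K XX X XX X R id;
         I_R = tensor_unassoc K X X X \<circ> tensor_map K X XX X XX id R \<circ> tensor_assoc K X X X
     in R \<in> linear_maps K XX XX \<and>
        (\<forall>t\<in>carrier (tensor_module K XX X). R_I (I_R (R_I t)) = I_R (R_I (I_R t))))"

end

theory Submission
  imports Defs
begin

text \<open>For \<open>u, v, w \<in> X\<close> the two sides are
  \<open>w\<^sup>(\<^sup>1\<^sup>) \<otimes> v\<^sup>(\<^sup>1\<^sup>)\<cdot>\<nu>(w\<^sup>(\<^sup>2\<^sup>)) \<otimes> u\<cdot>\<nu>(v\<^sup>(\<^sup>2\<^sup>)) \<nu>(w\<^sup>(\<^sup>3\<^sup>))\<close> and
  \<open>w\<^sup>(\<^sup>1\<^sup>) \<otimes> (v\<cdot>\<nu>(w\<^sup>(\<^sup>3\<^sup>)))\<^sup>(\<^sup>1\<^sup>) \<otimes> u\<cdot>\<nu>(w\<^sup>(\<^sup>2\<^sup>)) \<nu>((v\<cdot>\<nu>(w\<^sup>(\<^sup>3\<^sup>)))\<^sup>(\<^sup>2\<^sup>))\<close>.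
  Since \<open>H\<close> is cocommutative, \<open>S\<close> and hence \<open>\<nu>\<close> is a coalgebra map, and so is the action
  \<open>X \<otimes> H \<rightarrow> X\<close>; moreover \<open>\<nu>(v\<cdot>g) = S(g\<^sup>(\<^sup>1\<^sup>)) \<nu>(v) g\<^sup>(\<^sup>2\<^sup>)\<close>. With \<open>k = \<nu>(w\<^sup>(\<^sup>2\<^sup>))\<close> the second side becomes
  \<open>w\<^sup>(\<^sup>1\<^sup>) \<otimes> v\<^sup>(\<^sup>1\<^sup>)\<cdot>k\<^sup>(\<^sup>2\<^sup>) \<otimes> u\<cdot>k\<^sup>(\<^sup>1\<^sup>) S(k\<^sup>(\<^sup>3\<^sup>)) \<nu>(v\<^sup>(\<^sup>2\<^sup>)) k\<^sup>(\<^sup>4\<^sup>)\<close>, where \<open>k\<^sup>(\<^sup>1\<^sup>) S(k\<^sup>(\<^sup>3\<^sup>))\<close> cancels after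
  exchanging \<open>k\<^sup>(\<^sup>1\<^sup>)\<close> and \<open>k\<^sup>(\<^sup>2\<^sup>)\<close>.\<close>

section \<open>Linear maps\<close>

lemma linear_mapsI:
  assumes "\<And>x. x \<in> carrier M \<Longrightarrow> f x \<in> carrier N"
    and "\<And>x y. \<lbrakk>x \<in> carrier M; y \<in> carrier M\<rbrakk> \<Longrightarrow> f (x \<oplus>\<^bsub>M\<^esub> y) = f x \<oplus>\<^bsub>N\<^esub> f y"
    and "\<And>a x. \<lbrakk>a \<in> carrier K; x \<in> carrier M\<rbrakk> \<Longrightarrow> f (a \<odot>\<^bsub>M\<^esub> x) = a \<odot>\<^bsub>N\<^esub> f x"
  shows "f \<in> linear_maps K M N"
  using assms by (auto simp: linear_maps_def)

lemma linear_maps_closed: "\<lbrakk>f \<in> linear_maps K M N; x \<in> carrier M\<rbrakk> \<Longrightarrow> f x \<in> carrier N"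
  and linear_maps_add:
    "\<lbrakk>f \<in> linear_maps K M N; x \<in> carrier M; y \<in> carrier M\<rbrakk> \<Longrightarrow> f (x \<oplus>\<^bsub>M\<^esub> y) = f x \<oplus>\<^bsub>N\<^esub> f y"
  and linear_maps_smult:
    "\<lbrakk>f \<in> linear_maps K M N; a \<in> carrier K; x \<in> carrier M\<rbrakk> \<Longrightarrow> f (a \<odot>\<^bsub>M\<^esub> x) = a \<odot>\<^bsub>N\<^esub> f x"
  by (auto simp: linear_maps_def)

lemma linear_maps_ident: "(\<lambda>x. x) \<in> linear_maps K M M"
  by (simp add: linear_maps_def)

lemma linear_maps_compose:
  "\<lbrakk>f \<in> linear_maps K N P; g \<in> linear_maps K M N\<rbrakk> \<Longrightarrow> (\<lambda>x. f (g x)) \<in> linear_maps K M P"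
  by (auto simp: linear_maps_def Pi_iff)

text \<open>Commutativity of \<open>K\<close> is what makes this work: the fixed scalar
  \<open>a\<close> and the scalar pulled out of \<open>f\<close> have to change places.\<close>

lemma linear_maps_smult_const:
  assumes "module K N" "a \<in> carrier K" "f \<in> linear_maps K M N"
  shows "(\<lambda>x. a \<odot>\<^bsub>N\<^esub> f x) \<in> linear_maps K M N"
proof -
  interpret N: module K N by fact
  show ?thesis
    using assms(2,3) by (intro linear_mapsI)
      (auto simp: linear_maps_closed linear_maps_add linear_maps_smult N.smult_r_distr
         N.smult_assoc1[symmetric] N.R.m_comm)
qed

text \<open>Here the scalar depends on the variable. The rule serves terms such as \<epsilon>
  applied to one Sweedler component times a vector; \<open>base_module\<close> regards
  \<open>K\<close> as a module over itself.\<close>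

lemma linear_maps_smult_left:
  assumes "module K N" "y \<in> carrier N" "f \<in> linear_maps K M (base_module K)"
  shows "(\<lambda>x. f x \<odot>\<^bsub>N\<^esub> y) \<in> linear_maps K M N"
proof -
  interpret N: module K N by fact
  show ?thesis
    using assms(2,3) by (intro linear_mapsI)
      (auto simp: linear_maps_def base_module_def Pi_iff N.smult_l_distr N.smult_assoc1)
qed

lemma linear_maps_zero:
  assumes "module K M" "module K N" "f \<in> linear_maps K M N"
  shows "f \<zero>\<^bsub>M\<^esub> = \<zero>\<^bsub>N\<^esub>"
proof -
  interpret M: module K M by fact
  interpret N: module K N by fact
  \<comment> \<open>\<open>linear_maps\<close> demands nothing at zero, so zero is written as a
    multiple of itself by the scalar zero and homogeneity is used.\<close>
  have "f (\<zero>\<^bsub>K\<^esub> \<odot>\<^bsub>M\<^esub> \<zero>\<^bsub>M\<^esub>) = \<zero>\<^bsub>K\<^esub> \<odot>\<^bsub>N\<^esub> f \<zero>\<^bsub>M\<^esub>"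
    by (rule linear_maps_smult[OF assms(3)]) auto
  thus ?thesis using linear_maps_closed[OF assms(3)] by simp
qed

lemma linear_maps_finsum:
  assumes "module K M" "module K N" "f \<in> linear_maps K M N"
    and "finite A" "g \<in> A \<rightarrow> carrier M"
  shows "f (\<Oplus>\<^bsub>M\<^esub>i\<in>A. g i) = (\<Oplus>\<^bsub>N\<^esub>i\<in>A. f (g i))"
proof -
  interpret M: module K M by fact
  interpret N: module K N by fact
  show ?thesis using assms(4,5)
  proof (induction A)
    case empty
    show ?case using linear_maps_zero[OF assms(1-3)] by simp
  next
    case (insert a A)
    then have "g \<in> A \<rightarrow> carrier M" "g a \<in> carrier M" by auto
    moreover from this have "(\<lambda>i. f (g i)) \<in> A \<rightarrow> carrier N" "f (g a) \<in> carrier N"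
      using linear_maps_closed[OF assms(3)] by auto
    ultimately show ?case using insert linear_maps_add[OF assms(3)]
      by simp
  qed
qed

text \<open>Underlies the exchange of two independent Sweedler sums, which are finite sums over the
  supports of two representatives.\<close>

lemma (in abelian_monoid) finsum_swap:
  assumes "finite A" "finite B" "\<And>i j. \<lbrakk>i \<in> A; j \<in> B\<rbrakk> \<Longrightarrow> f i j \<in> carrier G"
  shows "(\<Oplus>i\<in>A. \<Oplus>j\<in>B. f i j) = (\<Oplus>j\<in>B. \<Oplus>i\<in>A. f i j)"
  using assms(1,3)
proof (induction A)
  case empty
  then show ?case by (simp add: finsum_zero)
next
  case (insert a A)
  have "(\<Oplus>i\<in>insert a A. \<Oplus>j\<in>B. f i j) = (\<Oplus>j\<in>B. f a j) \<oplus> (\<Oplus>i\<in>A. \<Oplus>j\<in>B. f i j)"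
    using insert by (intro finsum_insert) (auto intro!: finsum_closed)
  also have "\<dots> = (\<Oplus>j\<in>B. f a j) \<oplus> (\<Oplus>j\<in>B. \<Oplus>i\<in>A. f i j)"
    using insert by simp
  also have "\<dots> = (\<Oplus>j\<in>B. f a j \<oplus> (\<Oplus>i\<in>A. f i j))"
    using insert by (intro finsum_addf[symmetric]) (auto intro!: finsum_closed)
  also have "\<dots> = (\<Oplus>j\<in>B. \<Oplus>i\<in>insert a A. f i j)"
    using insert by (intro finsum_cong' refl finsum_insert[symmetric]) (auto intro!: finsum_closed a_closed)
  finally show ?case .
qed


section \<open>Free modules\<close>

lemma module_free_module:
  assumes "cring K"
  shows "module K (free_module K B)"
proof -
  interpret cring K by fact
  \<comment> \<open>Supports of sums and multiples stay inside the supports of the operands;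
    \<open>add\<close> and \<open>smult\<close> give finiteness, \<open>supp\<close> the restriction
    to \<open>B\<close>.\<close>
  have add: "finite {s. f s \<oplus>\<^bsub>K\<^esub> g s \<noteq> \<zero>\<^bsub>K\<^esub>}"
    if "finite {s. f s \<noteq> \<zero>\<^bsub>K\<^esub>}" "finite {s. g s \<noteq> \<zero>\<^bsub>K\<^esub>}" for f g :: "'c \<Rightarrow> 'a"
    by (rule finite_subset[OF _ finite_UnI[OF that]]) auto
  have smult: "finite {s. a \<otimes>\<^bsub>K\<^esub> f s \<noteq> \<zero>\<^bsub>K\<^esub>}"
    if "finite {s. f s \<noteq> \<zero>\<^bsub>K\<^esub>}" "a \<in> carrier K" for f :: "'c \<Rightarrow> 'a" and a
    by (rule finite_subset[OF _ that(1)]) (use that(2) in auto)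
  have supp: "s \<in> B"
    if "f s \<oplus>\<^bsub>K\<^esub> g s \<noteq> \<zero>\<^bsub>K\<^esub>" "{s. f s \<noteq> \<zero>\<^bsub>K\<^esub>} \<subseteq> B" "{s. g s \<noteq> \<zero>\<^bsub>K\<^esub>} \<subseteq> B"
    for f g :: "'c \<Rightarrow> 'a" and s
  proof (rule ccontr)
    assume "s \<notin> B"
    hence "f s = \<zero>\<^bsub>K\<^esub>" "g s = \<zero>\<^bsub>K\<^esub>" using that by auto
    with that(1) show False by simp
  qed
  show ?thesis
  proof (rule moduleI)
    show "abelian_group (free_module K B)"
    proof (rule abelian_groupI)
      fix x assume x: "x \<in> carrier (free_module K B)"
      have "(\<lambda>s. \<ominus>\<^bsub>K\<^esub> x s) \<in> carrier (free_module K B)"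
        using x by (auto simp: free_module_def elim!: rev_finite_subset)
      thus "\<exists>y\<in>carrier (free_module K B). y \<oplus>\<^bsub>free_module K B\<^esub> x = \<zero>\<^bsub>free_module K B\<^esub>"
        using x by (intro bexI[of _ "\<lambda>s. \<ominus>\<^bsub>K\<^esub> x s"]) (auto simp: free_module_def l_neg)
    qed (auto simp: free_module_def a_ac add intro: supp)
  qed (auto simp: free_module_def smult l_distr r_distr m_assoc assms)
qed

context
  fixes K :: "('k, 'm) ring_scheme" and B :: "'s set"
  assumes K: "cring K"
begin

interpretation K: cring K by (rule K)
interpretation F: module K "free_module K B" by (rule module_free_module[OF K])

lemma free_gen_closed: "s \<in> B \<Longrightarrow> free_gen K s \<in> carrier (free_module K B)"
  by (auto simp: free_module_def free_gen_def)

lemma free_module_finsum_apply: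
  assumes "finite A" "g \<in> A \<rightarrow> carrier (free_module K B)"
  shows "(\<Oplus>\<^bsub>free_module K B\<^esub>i\<in>A. g i) s = (\<Oplus>\<^bsub>K\<^esub>i\<in>A. g i s)"
  using assms
proof (induction A)
  case empty
  have "\<zero>\<^bsub>free_module K B\<^esub> s = \<zero>\<^bsub>K\<^esub>" by (simp add: free_module_def)
  then show ?case by simp
next
  case (insert a A)
  then have "g \<in> A \<rightarrow> carrier (free_module K B)" "g a \<in> carrier (free_module K B)" by auto
  moreover from this have "(\<lambda>i. g i s) \<in> A \<rightarrow> carrier K" "g a s \<in> carrier K"
    by (auto simp: free_module_def)
  moreover have "(f \<oplus>\<^bsub>free_module K B\<^esub> h) s = f s \<oplus>\<^bsub>K\<^esub> h s" for f h
    by (simp add: free_module_def)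
  ultimately show ?case using insert by simp
qed

text \<open>Evaluated at a point t, at most the summand with s = t survives. The expansion is later
  pushed to the quotient to show that pure tensors span the tensor product.\<close>

lemma free_module_expand:
  assumes f: "f \<in> carrier (free_module K B)"
  shows "(\<Oplus>\<^bsub>free_module K B\<^esub>s\<in>{s. f s \<noteq> \<zero>\<^bsub>K\<^esub>}. f s \<odot>\<^bsub>free_module K B\<^esub> free_gen K s) = f"
proof
  fix t
  let ?A = "{s. f s \<noteq> \<zero>\<^bsub>K\<^esub>}"
  have A: "finite ?A" "?A \<subseteq> B" and fK: "\<And>s. f s \<in> carrier K"
    using f by (auto simp: free_module_def)
  have "(\<Oplus>\<^bsub>free_module K B\<^esub>s\<in>?A. f s \<odot>\<^bsub>free_module K B\<^esub> free_gen K s) t =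
      (\<Oplus>\<^bsub>K\<^esub>s\<in>?A. (f s \<odot>\<^bsub>free_module K B\<^esub> free_gen K s) t)"
    using A fK by (intro free_module_finsum_apply) (auto intro!: F.smult_closed free_gen_closed)
  also have "\<dots> = (\<Oplus>\<^bsub>K\<^esub>s\<in>?A. if t = s then f s else \<zero>\<^bsub>K\<^esub>)"
    using fK by (intro K.finsum_cong') (auto simp: free_module_def free_gen_def)
  also have "\<dots> = f t"
  proof (cases "t \<in> ?A")
    case True
    thus ?thesis using A fK K.finsum_singleton[of t ?A f] by auto
  next
    case False
    hence "(\<Oplus>\<^bsub>K\<^esub>s\<in>?A. if t = s then f s else \<zero>\<^bsub>K\<^esub>) = (\<Oplus>\<^bsub>K\<^esub>s\<in>?A. \<zero>\<^bsub>K\<^esub>)"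
      by (intro K.finsum_cong') auto
    with False show ?thesis by (simp add: K.finsum_zero)
  qed
  finally show "(\<Oplus>\<^bsub>free_module K B\<^esub>s\<in>?A. f s \<odot>\<^bsub>free_module K B\<^esub> free_gen K s) t = f t" .
qed

end

text \<open>The linear extension of \<open>h\<close> from the basis to the free module. It has the
  same shape as the sum in \<open>tensor_lift\<close>, with the representative as an explicit
  argument.\<close>

definition free_lift ::
  "('k, 'm) ring_scheme \<Rightarrow> ('k, 'c, 'q) module_scheme \<Rightarrow> ('s \<Rightarrow> 'c) \<Rightarrow> ('s \<Rightarrow> 'k) \<Rightarrow> 'c" where
  "free_lift K P h f = (\<Oplus>\<^bsub>P\<^esub>s\<in>{s. f s \<noteq> \<zero>\<^bsub>K\<^esub>}. f s \<odot>\<^bsub>P\<^esub> h s)"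

lemma
  assumes "module K P" and h: "\<And>s. s \<in> B \<Longrightarrow> h s \<in> carrier P"
  shows free_lift_linear: "free_lift K P h \<in> linear_maps K (free_module K B) P"
    and free_lift_gen: "s \<in> B \<Longrightarrow> free_lift K P h (free_gen K s) = h s"
proof -
  interpret P: module K P by fact
  have supp: "finite {s. f s \<noteq> \<zero>\<^bsub>K\<^esub>}" "{s. f s \<noteq> \<zero>\<^bsub>K\<^esub>} \<subseteq> B" "\<And>s. f s \<in> carrier K"
    if "f \<in> carrier (free_module K B)" for f
    using that by (auto simp: free_module_def)
  \<comment> \<open>The summation range depends on \<open>f\<close>. Padding with zero terms allows
    one common finite range for the sums belonging to f, g and f + g.\<close>
  have extend: "free_lift K P h f = (\<Oplus>\<^bsub>P\<^esub>s\<in>A. f s \<odot>\<^bsub>P\<^esub> h s)"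
    if "f \<in> carrier (free_module K B)" "finite A" "{s. f s \<noteq> \<zero>\<^bsub>K\<^esub>} \<subseteq> A" "A \<subseteq> B" for f A
    unfolding free_lift_def using that supp[OF that(1)] h
    by (intro P.add.finprod_mono_neutral_cong_left) auto
  interpret F: module K "free_module K B" by (rule module_free_module) (rule P.R.is_cring)
  show "free_lift K P h \<in> linear_maps K (free_module K B) P"
  proof (rule linear_mapsI)
    fix f assume f: "f \<in> carrier (free_module K B)"
    show "free_lift K P h f \<in> carrier P"
      unfolding free_lift_def using supp[OF f] h by (intro P.finsum_closed) auto
    fix a assume a: "a \<in> carrier K"
    have "free_lift K P h (a \<odot>\<^bsub>free_module K B\<^esub> f) =
        (\<Oplus>\<^bsub>P\<^esub>s\<in>{s. f s \<noteq> \<zero>\<^bsub>K\<^esub>}. (a \<odot>\<^bsub>free_module K B\<^esub> f) s \<odot>\<^bsub>P\<^esub> h s)"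
      using supp[OF f] f a by (intro extend) (auto, auto simp: free_module_def)
    also have "\<dots> = (\<Oplus>\<^bsub>P\<^esub>s\<in>{s. f s \<noteq> \<zero>\<^bsub>K\<^esub>}. a \<odot>\<^bsub>P\<^esub> (f s \<odot>\<^bsub>P\<^esub> h s))"
      using supp[OF f] a h
      by (intro P.finsum_cong') (auto simp: free_module_def P.smult_assoc1 subset_iff)
    also have "\<dots> = a \<odot>\<^bsub>P\<^esub> free_lift K P h f"
      unfolding free_lift_def using supp[OF f] a h
      by (intro P.finsum_smult_ldistr[symmetric]) auto
    finally show "free_lift K P h (a \<odot>\<^bsub>free_module K B\<^esub> f) = a \<odot>\<^bsub>P\<^esub> free_lift K P h f" .
  next
    fix f g assume f: "f \<in> carrier (free_module K B)" and g: "g \<in> carrier (free_module K B)"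
    let ?A = "{s. f s \<noteq> \<zero>\<^bsub>K\<^esub>} \<union> {s. g s \<noteq> \<zero>\<^bsub>K\<^esub>}"
    have A: "finite ?A" "?A \<subseteq> B" using supp(1,2)[OF f] supp(1,2)[OF g] by auto
    have hA: "s \<in> ?A \<Longrightarrow> h s \<in> carrier P" for s using A h by blast
    have "free_lift K P h (f \<oplus>\<^bsub>free_module K B\<^esub> g) =
        (\<Oplus>\<^bsub>P\<^esub>s\<in>?A. (f \<oplus>\<^bsub>free_module K B\<^esub> g) s \<odot>\<^bsub>P\<^esub> h s)"
      using f g A by (intro extend) (auto, auto simp: free_module_def)
    also have "\<dots> = (\<Oplus>\<^bsub>P\<^esub>s\<in>?A. f s \<odot>\<^bsub>P\<^esub> h s \<oplus>\<^bsub>P\<^esub> g s \<odot>\<^bsub>P\<^esub> h s)"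
      using supp(3)[OF f] supp(3)[OF g] hA
      by (intro P.finsum_cong') (auto simp: free_module_def P.smult_l_distr)
    also have "\<dots> = (\<Oplus>\<^bsub>P\<^esub>s\<in>?A. f s \<odot>\<^bsub>P\<^esub> h s) \<oplus>\<^bsub>P\<^esub> (\<Oplus>\<^bsub>P\<^esub>s\<in>?A. g s \<odot>\<^bsub>P\<^esub> h s)"
      using supp(3)[OF f] supp(3)[OF g] hA by (intro P.finsum_addf) auto
    also have "\<dots> = free_lift K P h f \<oplus>\<^bsub>P\<^esub> free_lift K P h g"
      using f g A by (subst (1 2) extend[of _ ?A]) auto
    finally show "free_lift K P h (f \<oplus>\<^bsub>free_module K B\<^esub> g) =
        free_lift K P h f \<oplus>\<^bsub>P\<^esub> free_lift K P h g" .
  qed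
  assume s: "s \<in> B"
  have "free_lift K P h (free_gen K s) = (\<Oplus>\<^bsub>P\<^esub>t\<in>{s}. free_gen K s t \<odot>\<^bsub>P\<^esub> h t)"
    using s by (intro extend free_gen_closed P.R.is_cring) (auto simp: free_gen_def)
  thus "free_lift K P h (free_gen K s) = h s"
    using s h by (simp add: free_gen_def)
qed

section \<open>Tensor products\<close>

text \<open>Bundles the two factors of a tensor product while its theory is developed; afterwards
  the results are restated with explicit module premises.\<close>

locale two_modules = M: module K M + N: module K N
  for K :: "('k, 'm) ring_scheme" and M :: "('k, 'a, 'n) module_scheme"
    and N :: "('k, 'b, 'p) module_scheme"
begin

abbreviation "F \<equiv> free_module K (carrier M \<times> carrier N)"
abbreviation "U \<equiv> tensor_kernel K M N"
abbreviation "T \<equiv> tensor_module K M N"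

sublocale F: module K F
  by (rule module_free_module) (rule M.R.is_cring)

lemma free_gen_in_F: "\<lbrakk>x \<in> carrier M; y \<in> carrier N\<rbrakk> \<Longrightarrow> free_gen K (x, y) \<in> carrier F"
  by (simp add: free_gen_closed M.R.is_cring)

lemma bilinear_relations_closed: "bilinear_relations K M N \<subseteq> carrier F"
  by (auto simp: bilinear_relations_def Let_def intro!: F.minus_closed F.a_closed F.smult_closed
        free_gen_in_F)

lemma submodule_tensor_kernel: "submodule U K F"
proof (rule F.submoduleI)
  \<comment> \<open>The whole of \<open>F\<close> is one of the submodules being intersected, so
    \<open>U\<close> lies inside it.\<close>
  have "submodule (carrier F) K F" by (rule F.carrier_is_submodule)
  thus "U \<subseteq> carrier F"
    using bilinear_relations_closed by (auto simp: tensor_kernel_def)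
next
  show "\<zero>\<^bsub>F\<^esub> \<in> U"
  proof (unfold tensor_kernel_def, safe)
    fix V assume "submodule V K F"
    then show "\<zero>\<^bsub>F\<^esub> \<in> V" using subgroup.one_closed[OF submodule.axioms(1)] by fastforce
  qed
qed (auto simp: tensor_kernel_def F.submoduleE intro: submodule.smult_closed)

lemma bilinear_relations_in_kernel: "bilinear_relations K M N \<subseteq> U"
  by (auto simp: tensor_kernel_def)

text \<open>Makes the facts on cosets of subgroups of an abelian group available for
  \<open>U\<close>.\<close>

sublocale U: abelian_subgroup U F
  by (rule abelian_subgroupI3, rule additive_subgroupI)
     (auto intro: submodule.axioms(1)[OF submodule_tensor_kernel] F.abelian_group_axioms)

text \<open>The canonical projection from \<open>F\<close> onto its quotient by
  \<open>U\<close>.\<close>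

definition coset :: "('a \<times> 'b \<Rightarrow> 'k) \<Rightarrow> ('a \<times> 'b \<Rightarrow> 'k) set" where
  "coset f = U +>\<^bsub>F\<^esub> f"

lemma carrier_tensor_module: "carrier T = coset ` carrier F"
  by (auto simp: tensor_module_def Let_def A_RCOSETS_def' coset_def)

lemma coset_closed: "f \<in> carrier F \<Longrightarrow> coset f \<in> carrier T"
  by (simp add: carrier_tensor_module)

lemma cosetE:
  assumes "t \<in> carrier T"
  obtains f where "f \<in> carrier F" "t = coset f"
  using assms by (auto simp: carrier_tensor_module)

lemma coset_eq_iff:
  assumes "f \<in> carrier F" "g \<in> carrier F"
  shows "coset f = coset g \<longleftrightarrow> f \<ominus>\<^bsub>F\<^esub> g \<in> U"
proof -
  have "coset f = coset g \<longleftrightarrow> f \<in> coset g"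
  proof
    show "f \<in> coset g" if "coset f = coset g"
      using that U.a_repr_independenceD[OF assms(1), of g] by (simp add: coset_def)
    show "coset f = coset g" if "f \<in> coset g"
      using U.a_repr_independence'[OF _ assms(2)] that by (simp add: coset_def)
  qed
  thus ?thesis using U.a_rcos_module[OF assms(2,1)] by (simp add: coset_def F.minus_eq)
qed

lemma coset_eqI:
  assumes "f \<in> carrier F" "g \<in> carrier F" "f \<ominus>\<^bsub>F\<^esub> g \<in> bilinear_relations K M N"
  shows "coset f = coset g"
  using assms coset_eq_iff bilinear_relations_in_kernel by blast

lemma coset_add:
  "\<lbrakk>f \<in> carrier F; g \<in> carrier F\<rbrakk> \<Longrightarrow> coset f \<oplus>\<^bsub>T\<^esub> coset g = coset (f \<oplus>\<^bsub>F\<^esub> g)"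
  by (simp add: tensor_module_def Let_def coset_def U.a_rcos_sum)

text \<open>The scalar multiple in \<open>tensor_module\<close> is a union over all representatives.
  Since \<open>U\<close> is closed under scalars, all members of that union are the same coset, so
  the union is this coset.\<close>

lemma coset_smult:
  assumes a: "a \<in> carrier K" and f: "f \<in> carrier F"
  shows "a \<odot>\<^bsub>T\<^esub> coset f = coset (a \<odot>\<^bsub>F\<^esub> f)"
proof -
  have "coset (a \<odot>\<^bsub>F\<^esub> g) = coset (a \<odot>\<^bsub>F\<^esub> f)" if g: "g \<in> coset f" for g
  proof -
    have gF: "g \<in> carrier F" using f g unfolding coset_def by (rule U.a_elemrcos_carrier)
    have "g \<ominus>\<^bsub>F\<^esub> f \<in> U" using g U.a_rcos_module[OF f gF] by (simp add: coset_def F.minus_eq)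
    hence "a \<odot>\<^bsub>F\<^esub> (g \<ominus>\<^bsub>F\<^esub> f) \<in> U" using a submodule.smult_closed[OF submodule_tensor_kernel] by blast
    moreover have "a \<odot>\<^bsub>F\<^esub> (g \<ominus>\<^bsub>F\<^esub> f) = a \<odot>\<^bsub>F\<^esub> g \<ominus>\<^bsub>F\<^esub> a \<odot>\<^bsub>F\<^esub> f"
      using a f gF by (simp add: a_minus_def F.smult_r_distr F.smult_r_minus)
    ultimately show ?thesis using a f gF by (subst coset_eq_iff) auto
  qed
  moreover have "f \<in> coset f" using f unfolding coset_def by (rule U.a_rcos_self)
  ultimately have "(\<Union>g\<in>coset f. coset (a \<odot>\<^bsub>F\<^esub> g)) = coset (a \<odot>\<^bsub>F\<^esub> f)" by blast
  thus ?thesis by (simp add: tensor_module_def Let_def coset_def)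
qed

lemma zero_tensor_module: "\<zero>\<^bsub>T\<^esub> = coset \<zero>\<^bsub>F\<^esub>"
  using F.a_coset_add_zero[OF U.a_subset] by (simp add: tensor_module_def Let_def coset_def)

text \<open>Every element is a coset and the operations act on representatives, so the laws descend
  from \<open>F\<close>.\<close>

lemma module_tensor_module: "module K T"
proof -
  have T: "abelian_group T"
  proof (rule abelian_groupI)
    fix t assume "t \<in> carrier T"
    then obtain f where f: "f \<in> carrier F" "t = coset f" by (auto simp: carrier_tensor_module)
    then show "\<exists>u\<in>carrier T. u \<oplus>\<^bsub>T\<^esub> t = \<zero>\<^bsub>T\<^esub>"
      by (intro bexI[of _ "coset (\<ominus>\<^bsub>F\<^esub> f)"])
        (simp_all add: coset_add F.l_neg zero_tensor_module coset_closed)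
  qed (((erule cosetE)+)?, simp add: coset_closed coset_add zero_tensor_module F.a_ac)+
  show ?thesis
    by (rule moduleI; ((erule cosetE)+)?)
      (simp_all add: coset_closed coset_add coset_smult T M.R.is_cring F.smult_l_distr
        F.smult_r_distr F.smult_assoc1)
qed

lemma coset_linear: "coset \<in> linear_maps K F T"
  by (rule linear_mapsI) (simp_all add: coset_closed coset_add coset_smult)

lemma pure_tensor_eq_coset: "pure_tensor K M N x y = coset (free_gen K (x, y))"
  by (simp add: pure_tensor_def coset_def)

lemma pure_tensor_closed:
  "\<lbrakk>x \<in> carrier M; y \<in> carrier N\<rbrakk> \<Longrightarrow> pure_tensor K M N x y \<in> carrier T"
  by (simp add: pure_tensor_eq_coset coset_closed free_gen_in_F)

text \<open>For each law the difference of the two sides, taken in \<open>F\<close>, is one of the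
  elements of \<open>bilinear_relations\<close>, hence vanishes in the quotient.\<close>

lemma pure_tensor_linear_left:
  assumes y: "y \<in> carrier N"
  shows "(\<lambda>x. pure_tensor K M N x y) \<in> linear_maps K M T"
proof (rule linear_mapsI)
  fix x x' assume x: "x \<in> carrier M" "x' \<in> carrier M"
  have "coset (free_gen K (x \<oplus>\<^bsub>M\<^esub> x', y)) =
      coset (free_gen K (x, y) \<oplus>\<^bsub>F\<^esub> free_gen K (x', y))"
    by (intro coset_eqI F.a_closed free_gen_in_F)
      (use x y in \<open>auto simp: bilinear_relations_def Let_def\<close>)
  then show "pure_tensor K M N (x \<oplus>\<^bsub>M\<^esub> x') y =
      pure_tensor K M N x y \<oplus>\<^bsub>T\<^esub> pure_tensor K M N x' y"
    using x y by (simp add: pure_tensor_eq_coset coset_add free_gen_in_F)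
next
  fix a x assume ax: "a \<in> carrier K" "x \<in> carrier M"
  have "coset (free_gen K (a \<odot>\<^bsub>M\<^esub> x, y)) = coset (a \<odot>\<^bsub>F\<^esub> free_gen K (x, y))"
    by (intro coset_eqI F.smult_closed free_gen_in_F)
      (use ax y in \<open>auto simp: bilinear_relations_def Let_def\<close>)
  then show "pure_tensor K M N (a \<odot>\<^bsub>M\<^esub> x) y = a \<odot>\<^bsub>T\<^esub> pure_tensor K M N x y"
    using ax y by (simp add: pure_tensor_eq_coset coset_smult free_gen_in_F)
qed (use y in \<open>simp add: pure_tensor_closed\<close>)

lemma pure_tensor_linear_right:
  assumes x: "x \<in> carrier M"
  shows "(\<lambda>y. pure_tensor K M N x y) \<in> linear_maps K N T"
proof (rule linear_mapsI)
  fix y y' assume y: "y \<in> carrier N" "y' \<in> carrier N"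
  have "coset (free_gen K (x, y \<oplus>\<^bsub>N\<^esub> y')) =
      coset (free_gen K (x, y) \<oplus>\<^bsub>F\<^esub> free_gen K (x, y'))"
    by (intro coset_eqI F.a_closed free_gen_in_F)
      (use x y in \<open>auto simp: bilinear_relations_def Let_def\<close>)
  then show "pure_tensor K M N x (y \<oplus>\<^bsub>N\<^esub> y') =
      pure_tensor K M N x y \<oplus>\<^bsub>T\<^esub> pure_tensor K M N x y'"
    using x y by (simp add: pure_tensor_eq_coset coset_add free_gen_in_F)
next
  fix a y assume ay: "a \<in> carrier K" "y \<in> carrier N"
  have "coset (free_gen K (x, a \<odot>\<^bsub>N\<^esub> y)) = coset (a \<odot>\<^bsub>F\<^esub> free_gen K (x, y))"
    by (intro coset_eqI F.smult_closed free_gen_in_F)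
      (use ay x in \<open>auto simp: bilinear_relations_def Let_def\<close>)
  then show "pure_tensor K M N x (a \<odot>\<^bsub>N\<^esub> y) = a \<odot>\<^bsub>T\<^esub> pure_tensor K M N x y"
    using ay x by (simp add: pure_tensor_eq_coset coset_smult free_gen_in_F)
qed (use x in \<open>simp add: pure_tensor_closed\<close>)

section \<open>The universal property of the tensor product\<close>

text \<open>Cosets are non-empty, so the choice made in \<open>tensor_lift\<close> does select a
  representative.\<close>

lemma tensor_representative:
  assumes "t \<in> carrier T"
  shows "(SOME f. f \<in> t) \<in> carrier F" "coset (SOME f. f \<in> t) = t"
proof -
  obtain g where g: "g \<in> carrier F" "t = coset g"
    using assms by (auto simp: carrier_tensor_module)
  hence "g \<in> t" using U.a_rcos_self by (auto simp: coset_def)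
  hence f: "(SOME f. f \<in> t) \<in> t" by (rule someI[of "\<lambda>f. f \<in> t"])
  thus "(SOME f. f \<in> t) \<in> carrier F"
    using U.a_elemrcos_carrier[OF g(1)] g(2) by (simp add: coset_def)
  show "coset (SOME f. f \<in> t) = t"
    using f U.a_repr_independence'[OF _ g(1)] g(2) by (simp add: coset_def)
qed

lemma tensor_lift_eq_free_lift:
  "tensor_lift K M N P \<phi> t = free_lift K P (\<lambda>s. \<phi> (fst s) (snd s)) (SOME f. f \<in> t)"
  by (simp add: tensor_lift_def free_lift_def Let_def)

text \<open>Collects what is needed to manipulate the finite sum in \<open>tensor_lift\<close> term
  by term.\<close>

lemma representative_support:
  assumes "t \<in> carrier T"
  shows "finite {s. (SOME f. f \<in> t) s \<noteq> \<zero>\<^bsub>K\<^esub>}"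
    and "s \<in> {s. (SOME f. f \<in> t) s \<noteq> \<zero>\<^bsub>K\<^esub>} \<Longrightarrow> fst s \<in> carrier M \<and> snd s \<in> carrier N"
    and "(SOME f. f \<in> t) s \<in> carrier K"
proof -
  show "finite {s. (SOME f. f \<in> t) s \<noteq> \<zero>\<^bsub>K\<^esub>}"
    and "(SOME f. f \<in> t) s \<in> carrier K"
    using tensor_representative(1)[OF assms]
    by (simp_all add: free_module_def del: split_paired_All)
  have "{s. (SOME f. f \<in> t) s \<noteq> \<zero>\<^bsub>K\<^esub>} \<subseteq> carrier M \<times> carrier N"
    using tensor_representative(1)[OF assms] by (simp add: free_module_def)
  thus "fst s \<in> carrier M \<and> snd s \<in> carrier N" if "s \<in> {s. (SOME f. f \<in> t) s \<noteq> \<zero>\<^bsub>K\<^esub>}"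
    using that by (auto simp: mem_Times_iff)
qed

text \<open>The universal property: the linear extension \<open>?L\<close> of \<phi> to
  \<open>F\<close> kills the bilinearity relations and therefore \<open>U\<close>, so its value
  depends on the coset only.\<close>

lemma
  assumes "module K P"
    and right: "\<And>x. x \<in> carrier M \<Longrightarrow> (\<lambda>y. \<phi> x y) \<in> linear_maps K N P"
    and left: "\<And>y. y \<in> carrier N \<Longrightarrow> (\<lambda>x. \<phi> x y) \<in> linear_maps K M P"
  shows tensor_lift_linear: "tensor_lift K M N P \<phi> \<in> linear_maps K T P"
    and tensor_lift_pure:
      "\<lbrakk>x \<in> carrier M; y \<in> carrier N\<rbrakk> \<Longrightarrow> tensor_lift K M N P \<phi> (pure_tensor K M N x y) = \<phi> x y"
proof -
  interpret P: module K P by fact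
  let ?L = "free_lift K P (\<lambda>s. \<phi> (fst s) (snd s))"
  have closed: "\<phi> x y \<in> carrier P" if "x \<in> carrier M" "y \<in> carrier N" for x y
    using linear_maps_closed[OF right] that by blast
  have L: "?L \<in> linear_maps K F P"
    by (rule free_lift_linear) (use closed P.module_axioms in auto)
  have L_gen: "?L (free_gen K (x, y)) = \<phi> x y" if "x \<in> carrier M" "y \<in> carrier N" for x y
    by (subst free_lift_gen[where B = "carrier M \<times> carrier N"]) (use closed that P.module_axioms in auto)
  note L_closed = linear_maps_closed[OF L]
  have L_minus: "?L (f \<ominus>\<^bsub>F\<^esub> g) = ?L f \<ominus>\<^bsub>P\<^esub> ?L g" if "f \<in> carrier F" "g \<in> carrier F" for f g
  proof -
    have "?L (\<ominus>\<^bsub>F\<^esub> g) \<oplus>\<^bsub>P\<^esub> ?L g = \<zero>\<^bsub>P\<^esub>"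
      using that linear_maps_zero[OF F.module_axioms P.module_axioms L]
      by (simp add: linear_maps_add[OF L, symmetric] F.l_neg)
    hence "?L (\<ominus>\<^bsub>F\<^esub> g) = \<ominus>\<^bsub>P\<^esub> ?L g"
      using that L_closed by (intro P.minus_equality[symmetric]) auto
    thus ?thesis using that by (simp add: a_minus_def linear_maps_add[OF L])
  qed
  \<comment> \<open>The kernel of \<open>?L\<close>. As a submodule containing the relations it
    takes part in the intersection that defines \<open>U\<close>.\<close>
  define V where "V = {f \<in> carrier F. ?L f = \<zero>\<^bsub>P\<^esub>}"
  have "submodule V K F"
    unfolding V_def
  proof (rule F.submoduleI, goal_cases)
    case 2
    show ?case using linear_maps_zero[OF F.module_axioms P.module_axioms L] by simp
  next
    case (3 f)
    hence "?L (\<zero>\<^bsub>F\<^esub> \<ominus>\<^bsub>F\<^esub> f) = \<zero>\<^bsub>P\<^esub>"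
      using linear_maps_zero[OF F.module_axioms P.module_axioms L] by (simp add: L_minus P.minus_eq)
    with 3 show ?case by (simp add: F.minus_eq)
  qed (auto simp: linear_maps_add[OF L] linear_maps_smult[OF L])
  moreover have "bilinear_relations K M N \<subseteq> V"
    using bilinear_relations_closed unfolding V_def bilinear_relations_def Let_def
    by (auto simp: L_minus free_gen_in_F linear_maps_add[OF L] linear_maps_smult[OF L] L_gen
        linear_maps_add[OF right] linear_maps_add[OF left] linear_maps_smult[OF right]
        linear_maps_smult[OF left] closed P.r_neg a_minus_def[of P])
  ultimately have U_V: "U \<subseteq> V" by (auto simp: tensor_kernel_def)
  \<comment> \<open>Independence of the choice: the chosen representative and \<open>f\<close>
    differ by an element of \<open>U\<close>, on which \<open>?L\<close> is zero.\<close>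
  have eq: "tensor_lift K M N P \<phi> (coset f) = ?L f" if f: "f \<in> carrier F" for f
  proof -
    let ?g = "SOME g. g \<in> coset f"
    have t: "coset f \<in> carrier T" using f by (simp add: carrier_tensor_module)
    note g = tensor_representative[OF t]
    have "?g \<ominus>\<^bsub>F\<^esub> f \<in> V" using coset_eq_iff[OF g(1) f] g(2) U_V by auto
    hence "?L ?g \<ominus>\<^bsub>P\<^esub> ?L f = \<zero>\<^bsub>P\<^esub>" using L_minus[OF g(1) f] by (simp add: V_def)
    hence "\<ominus>\<^bsub>P\<^esub> (\<ominus>\<^bsub>P\<^esub> ?L f) = ?L ?g"
      using f g L_closed by (intro P.minus_equality) (auto simp: P.minus_eq)
    hence "?L ?g = ?L f" using f L_closed by simp
    thus ?thesis by (simp add: tensor_lift_eq_free_lift)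
  qed
  show "tensor_lift K M N P \<phi> \<in> linear_maps K T P"
    by (rule linear_mapsI; (erule cosetE)+)
      (simp_all add: coset_add coset_smult eq L_closed linear_maps_add[OF L]
        linear_maps_smult[OF L])
  show "tensor_lift K M N P \<phi> (pure_tensor K M N x y) = \<phi> x y"
    if "x \<in> carrier M" "y \<in> carrier N"
    using that by (simp add: pure_tensor_eq_coset eq free_gen_in_F L_gen)
qed

lemma tensor_lift_cong:
  assumes "module K P" "t \<in> carrier T"
    and "\<And>x y. \<lbrakk>x \<in> carrier M; y \<in> carrier N\<rbrakk> \<Longrightarrow> \<phi> x y = \<psi> x y"
    and "\<And>x y. \<lbrakk>x \<in> carrier M; y \<in> carrier N\<rbrakk> \<Longrightarrow> \<psi> x y \<in> carrier P"
  shows "tensor_lift K M N P \<phi> t = tensor_lift K M N P \<psi> t"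
proof -
  interpret P: module K P by fact
  show ?thesis
    unfolding tensor_lift_def Let_def using assms(3,4) representative_support[OF assms(2)]
    by (intro P.finsum_cong') auto
qed

lemma tensor_lift_closed:
  assumes "module K P" "t \<in> carrier T"
    and "\<And>x y. \<lbrakk>x \<in> carrier M; y \<in> carrier N\<rbrakk> \<Longrightarrow> \<phi> x y \<in> carrier P"
  shows "tensor_lift K M N P \<phi> t \<in> carrier P"
proof -
  interpret P: module K P by fact
  show ?thesis
    unfolding tensor_lift_def Let_def using assms(3) representative_support[OF assms(2)]
    by (intro P.finsum_closed) auto
qed

text \<open>Both sides are finite sums over the same chosen representative, so the linear map can be
  moved inside. This is the main means of pushing maps through Sweedler sums.\<close>

lemma linear_maps_tensor_lift:
  assumes "module K P" "module K Q" "f \<in> linear_maps K P Q" "t \<in> carrier T"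
    and closed: "\<And>x y. \<lbrakk>x \<in> carrier M; y \<in> carrier N\<rbrakk> \<Longrightarrow> \<phi> x y \<in> carrier P"
  shows "f (tensor_lift K M N P \<phi> t) = tensor_lift K M N Q (\<lambda>x y. f (\<phi> x y)) t"
proof -
  interpret P: module K P by fact
  interpret Q: module K Q by fact
  note rep = representative_support[OF assms(4)]
  show ?thesis
    unfolding tensor_lift_def Let_def using closed rep linear_maps_closed[OF assms(3)]
    by (subst linear_maps_finsum[OF assms(1-3)])
      (auto intro!: Q.finsum_cong' simp: linear_maps_smult[OF assms(3)])
qed

text \<open>With t fixed its representative is fixed too, and a finite combination of linear maps in
  z remains linear.\<close>

lemma tensor_lift_linear_param:
  assumes "module K L" "module K P" "t \<in> carrier T"
    and lin: "\<And>x y. \<lbrakk>x \<in> carrier M; y \<in> carrier N\<rbrakk> \<Longrightarrow> (\<lambda>z. \<phi> z x y) \<in> linear_maps K L P"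
  shows "(\<lambda>z. tensor_lift K M N P (\<phi> z) t) \<in> linear_maps K L P"
proof -
  interpret L: module K L by fact
  interpret P: module K P by fact
  note rep = representative_support[OF assms(3)]
  have closed: "\<phi> z x y \<in> carrier P" if "x \<in> carrier M" "y \<in> carrier N" "z \<in> carrier L" for x y z
    using linear_maps_closed[OF lin] that by blast
  show ?thesis
  proof (rule linear_mapsI)
    fix z assume z: "z \<in> carrier L"
    thus "tensor_lift K M N P (\<phi> z) t \<in> carrier P"
      using assms closed by (intro tensor_lift_closed) auto
    fix a assume a: "a \<in> carrier K"
    have "tensor_lift K M N P (\<phi> (a \<odot>\<^bsub>L\<^esub> z)) t = tensor_lift K M N P (\<lambda>x y. a \<odot>\<^bsub>P\<^esub> \<phi> z x y) t"
      using z a assms closed by (intro tensor_lift_cong) (auto simp: linear_maps_smult[OF lin])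
    \<comment> \<open>Multiplication by a is itself a linear map on \<open>P\<close> and is pulled
      out of the sum as such.\<close>
    also have "\<dots> = a \<odot>\<^bsub>P\<^esub> tensor_lift K M N P (\<phi> z) t"
      using z a assms closed
      by (intro linear_maps_tensor_lift[where f = "\<lambda>x. a \<odot>\<^bsub>P\<^esub> x", symmetric] linear_maps_smult_const
          linear_maps_ident) auto
    finally show "tensor_lift K M N P (\<phi> (a \<odot>\<^bsub>L\<^esub> z)) t = a \<odot>\<^bsub>P\<^esub> tensor_lift K M N P (\<phi> z) t" .
  next
    fix z z' assume z: "z \<in> carrier L" "z' \<in> carrier L"
    have "tensor_lift K M N P (\<phi> (z \<oplus>\<^bsub>L\<^esub> z')) t =
        tensor_lift K M N P (\<lambda>x y. \<phi> z x y \<oplus>\<^bsub>P\<^esub> \<phi> z' x y) t"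
      using z assms closed by (intro tensor_lift_cong) (auto simp: linear_maps_add[OF lin])
    also have "\<dots> = tensor_lift K M N P (\<phi> z) t \<oplus>\<^bsub>P\<^esub> tensor_lift K M N P (\<phi> z') t"
    proof -
      let ?f = "SOME f. f \<in> t"
      have "(\<Oplus>\<^bsub>P\<^esub>s\<in>{s. ?f s \<noteq> \<zero>\<^bsub>K\<^esub>}. ?f s \<odot>\<^bsub>P\<^esub> (\<phi> z (fst s) (snd s) \<oplus>\<^bsub>P\<^esub> \<phi> z' (fst s) (snd s))) =
          (\<Oplus>\<^bsub>P\<^esub>s\<in>{s. ?f s \<noteq> \<zero>\<^bsub>K\<^esub>}.
            ?f s \<odot>\<^bsub>P\<^esub> \<phi> z (fst s) (snd s) \<oplus>\<^bsub>P\<^esub> ?f s \<odot>\<^bsub>P\<^esub> \<phi> z' (fst s) (snd s))"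
        using z closed rep by (intro P.finsum_cong' refl) (auto simp: P.smult_r_distr)
      also have "\<dots> = (\<Oplus>\<^bsub>P\<^esub>s\<in>{s. ?f s \<noteq> \<zero>\<^bsub>K\<^esub>}. ?f s \<odot>\<^bsub>P\<^esub> \<phi> z (fst s) (snd s)) \<oplus>\<^bsub>P\<^esub>
          (\<Oplus>\<^bsub>P\<^esub>s\<in>{s. ?f s \<noteq> \<zero>\<^bsub>K\<^esub>}. ?f s \<odot>\<^bsub>P\<^esub> \<phi> z' (fst s) (snd s))"
        using z closed rep by (intro P.finsum_addf) auto
      finally show ?thesis by (simp add: tensor_lift_def Let_def)
    qed
    finally show "tensor_lift K M N P (\<phi> (z \<oplus>\<^bsub>L\<^esub> z')) t =
        tensor_lift K M N P (\<phi> z) t \<oplus>\<^bsub>P\<^esub> tensor_lift K M N P (\<phi> z') t" .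
  qed
qed

text \<open>The image under \<open>coset\<close> of the expansion of a representative in free
  generators. It expresses that pure tensors span.\<close>

lemma tensor_lift_pure_tensor:
  assumes t: "t \<in> carrier T"
  shows "tensor_lift K M N T (pure_tensor K M N) t = t"
proof -
  let ?f = "SOME f. f \<in> t"
  interpret T: module K T by (rule module_tensor_module)
  note f = tensor_representative[OF t] and rep = representative_support[OF t]
  have "t = coset (\<Oplus>\<^bsub>F\<^esub>s\<in>{s. ?f s \<noteq> \<zero>\<^bsub>K\<^esub>}. ?f s \<odot>\<^bsub>F\<^esub> free_gen K s)"
    using free_module_expand[OF M.R.is_cring f(1)] f(2) by simp
  also have "\<dots> = (\<Oplus>\<^bsub>T\<^esub>s\<in>{s. ?f s \<noteq> \<zero>\<^bsub>K\<^esub>}. coset (?f s \<odot>\<^bsub>F\<^esub> free_gen K s))"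
    using rep by (intro linear_maps_finsum[OF F.module_axioms T.module_axioms coset_linear])
      (auto intro!: F.smult_closed free_gen_closed M.R.is_cring)
  also have "\<dots> = tensor_lift K M N T (pure_tensor K M N) t"
    unfolding tensor_lift_def Let_def using rep
    by (intro T.finsum_cong') (auto simp: pure_tensor_eq_coset coset_smult free_gen_in_F
        intro!: T.smult_closed pure_tensor_closed[unfolded pure_tensor_eq_coset])
  finally show ?thesis ..
qed

text \<open>Applying a linear map to the expansion of t in pure tensors shows that its value at t is
  determined by its values on them.\<close>

lemma linear_maps_tensor_eqI:
  assumes "module K P" "f \<in> linear_maps K T P" "g \<in> linear_maps K T P" "t \<in> carrier T"
    and eq: "\<And>x y. \<lbrakk>x \<in> carrier M; y \<in> carrier N\<rbrakk> \<Longrightarrow>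
      f (pure_tensor K M N x y) = g (pure_tensor K M N x y)"
  shows "f t = g t"
proof -
  have expand: "h t = tensor_lift K M N P (\<lambda>x y. h (pure_tensor K M N x y)) t"
    if h: "h \<in> linear_maps K T P" for h
    using linear_maps_tensor_lift[OF module_tensor_module assms(1) h assms(4), of "pure_tensor K M N"]
      tensor_lift_pure_tensor[OF assms(4)] pure_tensor_closed by simp
  show ?thesis
    unfolding expand[OF assms(2)] expand[OF assms(3)]
    using assms pure_tensor_closed by (intro tensor_lift_cong) (auto intro: linear_maps_closed)
qed

end

text \<open>After the coefficients are moved inside, this is the exchange of two finite sums
  followed by the exchange of two scalars.\<close>

lemma tensor_lift_swap:
  assumes "two_modules K M N" "two_modules K M' N'" "module K P"
    and t: "t \<in> carrier (tensor_module K M N)" and t': "t' \<in> carrier (tensor_module K M' N')"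
    and closed: "\<And>a b c d. \<lbrakk>a \<in> carrier M; b \<in> carrier N; c \<in> carrier M'; d \<in> carrier N'\<rbrakk> \<Longrightarrow>
      \<phi> a b c d \<in> carrier P"
  shows "tensor_lift K M N P (\<lambda>a b. tensor_lift K M' N' P (\<lambda>c d. \<phi> a b c d) t') t =
    tensor_lift K M' N' P (\<lambda>c d. tensor_lift K M N P (\<lambda>a b. \<phi> a b c d) t) t'"
proof -
  interpret 1: two_modules K M N by fact
  interpret 2: two_modules K M' N' by fact
  interpret P: module K P by fact
  let ?f = "SOME f. f \<in> t" and ?g = "SOME f. f \<in> t'"
  let ?A = "{s. ?f s \<noteq> \<zero>\<^bsub>K\<^esub>}" and ?B = "{s. ?g s \<noteq> \<zero>\<^bsub>K\<^esub>}"
  let ?\<phi> = "\<lambda>s r. \<phi> (fst s) (snd s) (fst r) (snd r)"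
  note rep1 = "1.representative_support"[OF t]
  note rep2 = "2.representative_support"[OF t']
  have cl: "?\<phi> s r \<in> carrier P" if "s \<in> ?A" "r \<in> ?B" for s r
    using rep1(2)[OF that(1)] rep2(2)[OF that(2)] closed by auto
  have "tensor_lift K M N P (\<lambda>a b. tensor_lift K M' N' P (\<lambda>c d. \<phi> a b c d) t') t =
      (\<Oplus>\<^bsub>P\<^esub>s\<in>?A. \<Oplus>\<^bsub>P\<^esub>r\<in>?B. ?f s \<odot>\<^bsub>P\<^esub> (?g r \<odot>\<^bsub>P\<^esub> ?\<phi> s r))"
    unfolding tensor_lift_def[of K M N] tensor_lift_def[of K M' N'] Let_def
    using rep1 rep2 cl
    by (intro P.finsum_cong' refl P.finsum_smult_ldistr) (auto intro!: P.finsum_closed P.smult_closed)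
  also have "\<dots> = (\<Oplus>\<^bsub>P\<^esub>r\<in>?B. \<Oplus>\<^bsub>P\<^esub>s\<in>?A. ?f s \<odot>\<^bsub>P\<^esub> (?g r \<odot>\<^bsub>P\<^esub> ?\<phi> s r))"
    using rep1(1,3) rep2(1,3) cl by (intro P.finsum_swap) auto
  also have "\<dots> = (\<Oplus>\<^bsub>P\<^esub>r\<in>?B. \<Oplus>\<^bsub>P\<^esub>s\<in>?A. ?g r \<odot>\<^bsub>P\<^esub> (?f s \<odot>\<^bsub>P\<^esub> ?\<phi> s r))"
  proof -
    have comm: "a \<odot>\<^bsub>P\<^esub> (b \<odot>\<^bsub>P\<^esub> x) = b \<odot>\<^bsub>P\<^esub> (a \<odot>\<^bsub>P\<^esub> x)"
      if "a \<in> carrier K" "b \<in> carrier K" "x \<in> carrier P" for a b x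
      using that by (metis "1.M.R.m_comm" P.smult_assoc1)
    show ?thesis
      using rep1(3) rep2(3) cl
      by (intro P.finsum_cong' refl comm) (auto intro!: P.finsum_closed P.smult_closed)
  qed
  also have "\<dots> = tensor_lift K M' N' P (\<lambda>c d. tensor_lift K M N P (\<lambda>a b. \<phi> a b c d) t) t'"
    unfolding tensor_lift_def[of K M N] tensor_lift_def[of K M' N'] Let_def
    using rep1 rep2 cl
    by (intro P.finsum_cong' refl P.finsum_smult_ldistr[symmetric])
      (auto intro!: P.finsum_closed P.smult_closed)
  finally show ?thesis .
qed

section \<open>Closure rules for linear maps\<close>

text \<open>Resolution with the rules \<open>lin\<close> decides whether an expression in Sweedler notation is linear
  in a variable, or lies in a module: each rule is selected by the outermost operation and by the
  argument in which the bound variable occurs.\<close>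

named_theorems lin

lemma two_modulesI: "\<lbrakk>module K M; module K N\<rbrakk> \<Longrightarrow> two_modules K M N"
  by (rule two_modules.intro)

lemma module_tensor_module [lin]:
  "\<lbrakk>module K M; module K N\<rbrakk> \<Longrightarrow> module K (tensor_module K M N)"
  by (rule two_modules.module_tensor_module[OF two_modulesI])

lemma pure_tensor_closed [lin]:
  "\<lbrakk>module K M; module K N; x \<in> carrier M; y \<in> carrier N\<rbrakk> \<Longrightarrow>
    pure_tensor K M N x y \<in> carrier (tensor_module K M N)"
  by (rule two_modules.pure_tensor_closed[OF two_modulesI])

lemma pure_tensor_linear_left [lin]:
  "\<lbrakk>module K M; module K N; y \<in> carrier N; f \<in> linear_maps K L M\<rbrakk> \<Longrightarrow>
    (\<lambda>x. pure_tensor K M N (f x) y) \<in> linear_maps K L (tensor_module K M N)"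
  by (rule linear_maps_compose[OF two_modules.pure_tensor_linear_left[OF two_modulesI]])

lemma pure_tensor_linear_right [lin]:
  "\<lbrakk>module K M; module K N; x \<in> carrier M; f \<in> linear_maps K L N\<rbrakk> \<Longrightarrow>
    (\<lambda>y. pure_tensor K M N x (f y)) \<in> linear_maps K L (tensor_module K M N)"
  by (rule linear_maps_compose[OF two_modules.pure_tensor_linear_right[OF two_modulesI]])

lemma tensor_lift_closed [lin]:
  "\<lbrakk>module K M; module K N; module K P; t \<in> carrier (tensor_module K M N);
    \<And>x y. \<lbrakk>x \<in> carrier M; y \<in> carrier N\<rbrakk> \<Longrightarrow> \<phi> x y \<in> carrier P\<rbrakk> \<Longrightarrow>
    tensor_lift K M N P \<phi> t \<in> carrier P"
  by (rule two_modules.tensor_lift_closed[OF two_modulesI])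

text \<open>For a variable in the tensor argument; bilinearity of \<phi> turns into further goals
  for the same rules. The next rule but one treats a variable in the integrand.\<close>

lemma tensor_lift_linear [lin]:
  "\<lbrakk>module K M; module K N; module K P;
    \<And>x. x \<in> carrier M \<Longrightarrow> (\<lambda>y. \<phi> x y) \<in> linear_maps K N P;
    \<And>y. y \<in> carrier N \<Longrightarrow> (\<lambda>x. \<phi> x y) \<in> linear_maps K M P;
    f \<in> linear_maps K L (tensor_module K M N)\<rbrakk> \<Longrightarrow>
    (\<lambda>z. tensor_lift K M N P \<phi> (f z)) \<in> linear_maps K L P"
  by (rule linear_maps_compose[OF two_modules.tensor_lift_linear[OF two_modulesI]])

lemma tensor_lift_linear_param [lin]:
  "\<lbrakk>module K M; module K N; module K L; module K P; t \<in> carrier (tensor_module K M N);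
    \<And>x y. \<lbrakk>x \<in> carrier M; y \<in> carrier N\<rbrakk> \<Longrightarrow> (\<lambda>z. \<phi> z x y) \<in> linear_maps K L P\<rbrakk> \<Longrightarrow>
    (\<lambda>z. tensor_lift K M N P (\<phi> z) t) \<in> linear_maps K L P"
  by (rule two_modules.tensor_lift_linear_param[OF two_modulesI])

lemma smult_closed [lin]: "\<lbrakk>module K M; a \<in> carrier K; x \<in> carrier M\<rbrakk> \<Longrightarrow> a \<odot>\<^bsub>M\<^esub> x \<in> carrier M"
  by (rule module.smult_closed)

lemmas [lin] = linear_maps_ident linear_maps_smult_left linear_maps_smult_const

lemma tensor_lift_pure:
  "\<lbrakk>module K M; module K N; module K P;
    \<And>x. x \<in> carrier M \<Longrightarrow> (\<lambda>y. \<phi> x y) \<in> linear_maps K N P;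
    \<And>y. y \<in> carrier N \<Longrightarrow> (\<lambda>x. \<phi> x y) \<in> linear_maps K M P;
    x \<in> carrier M; y \<in> carrier N\<rbrakk> \<Longrightarrow>
    tensor_lift K M N P \<phi> (pure_tensor K M N x y) = \<phi> x y"
  by (rule two_modules.tensor_lift_pure[OF two_modulesI])

lemma tensor_lift_cong:
  "\<lbrakk>module K M; module K N; module K P; t \<in> carrier (tensor_module K M N);
    \<And>x y. \<lbrakk>x \<in> carrier M; y \<in> carrier N\<rbrakk> \<Longrightarrow> \<phi> x y = \<psi> x y;
    \<And>x y. \<lbrakk>x \<in> carrier M; y \<in> carrier N\<rbrakk> \<Longrightarrow> \<psi> x y \<in> carrier P\<rbrakk> \<Longrightarrow>
    tensor_lift K M N P \<phi> t = tensor_lift K M N P \<psi> t"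
  by (rule two_modules.tensor_lift_cong[OF two_modulesI])

lemma linear_maps_tensor_lift:
  "\<lbrakk>f \<in> linear_maps K P Q; module K M; module K N; module K P; module K Q;
    t \<in> carrier (tensor_module K M N);
    \<And>x y. \<lbrakk>x \<in> carrier M; y \<in> carrier N\<rbrakk> \<Longrightarrow> \<phi> x y \<in> carrier P\<rbrakk> \<Longrightarrow>
    f (tensor_lift K M N P \<phi> t) = tensor_lift K M N Q (\<lambda>x y. f (\<phi> x y)) t"
  by (rule two_modules.linear_maps_tensor_lift[OF two_modulesI])

lemma linear_maps_tensor_eqI:
  "\<lbrakk>f \<in> linear_maps K (tensor_module K M N) P; g \<in> linear_maps K (tensor_module K M N) P;
    module K M; module K N; module K P; t \<in> carrier (tensor_module K M N);
    \<And>x y. \<lbrakk>x \<in> carrier M; y \<in> carrier N\<rbrakk> \<Longrightarrow>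
      f (pure_tensor K M N x y) = g (pure_tensor K M N x y)\<rbrakk> \<Longrightarrow> f t = g t"
  by (rule two_modules.linear_maps_tensor_eqI[OF two_modulesI])


section \<open>Sweedler calculus in a cocommutative Hopf algebra\<close>

context cocommutative_hopf_algebra
begin

text \<open>A Sweedler sum with values in \<open>P\<close>; iterated components arise by nesting,
  the inner sum being taken over a component bound by the outer one.\<close>

abbreviation sw where "sw P \<phi> x \<equiv> tensor_lift K H H P \<phi> (\<Delta> x)"

lemma module_H [lin]: "module K H"
  by (rule module_axioms)

lemma comult_closed [lin]: "x \<in> carrier H \<Longrightarrow> \<Delta> x \<in> carrier (tensor_module K H H)"
  by (rule linear_maps_closed[OF comult_linear])

lemma counit_closed [lin]: "x \<in> carrier H \<Longrightarrow> \<epsilon> x \<in> carrier K"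
  using linear_maps_closed[OF counit_linear] by (simp add: base_module_def)

lemma antipode_closed [lin]: "x \<in> carrier H \<Longrightarrow> S x \<in> carrier H"
  by (rule linear_maps_closed[OF antipode_linear])

lemma mult_linear_left [lin]:
  "\<lbrakk>y \<in> carrier H; f \<in> linear_maps K L H\<rbrakk> \<Longrightarrow> (\<lambda>x. f x \<otimes>\<^bsub>H\<^esub> y) \<in> linear_maps K L H"
  by (rule linear_mapsI)
    (auto simp: linear_maps_closed linear_maps_add linear_maps_smult smult_mult_left l_distr)

lemma mult_linear_right [lin]:
  "\<lbrakk>x \<in> carrier H; f \<in> linear_maps K L H\<rbrakk> \<Longrightarrow> (\<lambda>y. x \<otimes>\<^bsub>H\<^esub> f y) \<in> linear_maps K L H"
  by (rule linear_mapsI)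
    (auto simp: linear_maps_closed linear_maps_add linear_maps_smult smult_mult_right r_distr)

lemmas [lin] = m_closed one_closed linear_maps_compose[OF comult_linear]
  linear_maps_compose[OF counit_linear] linear_maps_compose[OF antipode_linear]

lemma sw_cong:
  "\<lbrakk>module K P; x \<in> carrier H;
    \<And>a b. \<lbrakk>a \<in> carrier H; b \<in> carrier H\<rbrakk> \<Longrightarrow> \<phi> a b = \<psi> a b;
    \<And>a b. \<lbrakk>a \<in> carrier H; b \<in> carrier H\<rbrakk> \<Longrightarrow> \<psi> a b \<in> carrier P\<rbrakk> \<Longrightarrow> sw P \<phi> x = sw P \<psi> x"
  by (rule tensor_lift_cong) (assumption | rule lin)+

lemma sw_swap:
  "\<lbrakk>module K P; x \<in> carrier H; y \<in> carrier H;
    \<And>a b c d. \<lbrakk>a \<in> carrier H; b \<in> carrier H; c \<in> carrier H; d \<in> carrier H\<rbrakk> \<Longrightarrow> \<phi> a b c d \<in> carrier P\<rbrakk> \<Longrightarrow>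
    sw P (\<lambda>a b. sw P (\<lambda>c d. \<phi> a b c d) y) x = sw P (\<lambda>c d. sw P (\<lambda>a b. \<phi> a b c d) x) y"
  by (rule tensor_lift_swap) (assumption | rule lin two_modulesI)+

text \<open>Both sides are images of the two sides of the axiom \<open>coassoc\<close> under the
  linear map that the trilinear \<phi> induces on the triple tensor product.\<close>

lemma sw_coassoc:
  assumes [lin]: "module K P" "x \<in> carrier H"
    and l1: "\<And>y z. \<lbrakk>y \<in> carrier H; z \<in> carrier H\<rbrakk> \<Longrightarrow> (\<lambda>x. \<phi> x y z) \<in> linear_maps K H P"
    and l2: "\<And>x z. \<lbrakk>x \<in> carrier H; z \<in> carrier H\<rbrakk> \<Longrightarrow> (\<lambda>y. \<phi> x y z) \<in> linear_maps K H P"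
    and l3: "\<And>x y. \<lbrakk>x \<in> carrier H; y \<in> carrier H\<rbrakk> \<Longrightarrow> (\<lambda>z. \<phi> x y z) \<in> linear_maps K H P"
  shows "sw P (\<lambda>a b. sw P (\<lambda>c d. \<phi> c d b) a) x = sw P (\<lambda>a b. sw P (\<lambda>c d. \<phi> a c d) b) x"
proof -
  let ?HH = "tensor_module K H H" and ?R = "tensor_module K H (tensor_module K H H)"
  note [lin] = linear_maps_compose[OF l1] linear_maps_compose[OF l2] linear_maps_compose[OF l3]
    linear_maps_closed[OF l3]
  \<comment> \<open>The induced map on H tensor (H tensor H), lifted one factor at a time.\<close>
  let ?\<Phi> = "tensor_lift K H ?HH P (\<lambda>x t. tensor_lift K H H P (\<lambda>y z. \<phi> x y z) t)"
  have \<Phi>: "?\<Phi> \<in> linear_maps K ?R P"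
    by (rule tensor_lift_linear[where f = "\<lambda>x. x"]) (assumption | rule lin)+
  have \<Phi>_pure: "?\<Phi> (pure_tensor K H ?HH a t) = tensor_lift K H H P (\<lambda>y z. \<phi> a y z) t"
    if "a \<in> carrier H" "t \<in> carrier ?HH" for a t
    by (rule tensor_lift_pure) (assumption | rule lin that)+
  have "?\<Phi> (tensor_map K H H H ?HH id \<Delta> (\<Delta> x)) = sw P (\<lambda>a b. sw P (\<lambda>c d. \<phi> a c d) b) x"
    unfolding tensor_map_def id_def
    by (subst linear_maps_tensor_lift[OF \<Phi>]) (assumption | rule lin tensor_lift_cong \<Phi>_pure)+
  moreover
  \<comment> \<open>The rebracketed side is first written as a double sum of pure triples; only then
    is \<open>?\<Phi>\<close> moved inside, one sum after the other.\<close>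
  have "tensor_assoc K H H H (tensor_map K H H ?HH H \<Delta> id (\<Delta> x)) =
      sw ?R (\<lambda>a b. sw ?R (\<lambda>c d. pure_tensor K H ?HH c (pure_tensor K H H d b)) a) x"
    unfolding tensor_map_def tensor_assoc_def id_def Let_def
    by (subst linear_maps_tensor_lift[where f = "tensor_lift K ?HH H ?R _" and Q = ?R],
        rule tensor_lift_linear[where f = "\<lambda>x. x"])
      (assumption | rule lin tensor_lift_cong tensor_lift_pure)+
  moreover have "?\<Phi> (sw ?R (\<lambda>a b. sw ?R (\<lambda>c d. pure_tensor K H ?HH c (pure_tensor K H H d b)) a) x) =
      sw P (\<lambda>a b. ?\<Phi> (sw ?R (\<lambda>c d. pure_tensor K H ?HH c (pure_tensor K H H d b)) a)) x"
    by (rule linear_maps_tensor_lift[OF \<Phi>]) (assumption | rule lin)+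
  moreover have "\<dots> = sw P (\<lambda>a b. sw P (\<lambda>c d. ?\<Phi> (pure_tensor K H ?HH c (pure_tensor K H H d b))) a) x"
    by (rule sw_cong, rule_tac [3] linear_maps_tensor_lift[OF \<Phi>])
      (assumption | rule lin linear_maps_closed[OF \<Phi>])+
  moreover have "\<dots> = sw P (\<lambda>a b. sw P (\<lambda>c d. \<phi> c d b) a) x"
    by (assumption | rule sw_cong lin \<Phi>_pure[THEN trans] tensor_lift_pure)+
  ultimately show ?thesis using coassoc[of x] assms(2) by simp
qed

lemma sw_linear:
  "\<lbrakk>f \<in> linear_maps K P Q; module K P; module K Q; x \<in> carrier H;
    \<And>a b. \<lbrakk>a \<in> carrier H; b \<in> carrier H\<rbrakk> \<Longrightarrow> \<phi> a b \<in> carrier P\<rbrakk> \<Longrightarrow>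
    f (sw P \<phi> x) = sw Q (\<lambda>a b. f (\<phi> a b)) x"
  by (rule linear_maps_tensor_lift) (assumption | rule lin)+

text \<open>The lift of \<phi> is applied to the axiom \<open>cocommutative\<close>; on pure tensors
  \<open>tensor_swap\<close> exchanges the arguments of \<phi>.\<close>

lemma sw_cocomm:
  assumes [lin]: "module K P" "x \<in> carrier H"
    and l1: "\<And>y. y \<in> carrier H \<Longrightarrow> (\<lambda>x. \<phi> x y) \<in> linear_maps K H P"
    and l2: "\<And>x. x \<in> carrier H \<Longrightarrow> (\<lambda>y. \<phi> x y) \<in> linear_maps K H P"
  shows "sw P (\<lambda>a b. \<phi> b a) x = sw P \<phi> x"
proof -
  have lift: "tensor_lift K H H P \<phi> \<in> linear_maps K (tensor_module K H H) P"
    by (rule tensor_lift_linear[where f = "\<lambda>x. x"]) (assumption | rule lin l1 l2)+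
  have "sw P \<phi> x = tensor_lift K H H P \<phi> (tensor_swap K H H (\<Delta> x))"
    using cocommutative[OF assms(2)] by simp
  also have "\<dots> = sw P (\<lambda>a b. tensor_lift K H H P \<phi> (pure_tensor K H H b a)) x"
    unfolding tensor_swap_def
    by (rule linear_maps_tensor_lift[OF lift]) (assumption | rule lin)+
  also have "\<dots> = sw P (\<lambda>a b. \<phi> b a) x"
    by (assumption | rule sw_cong tensor_lift_pure lin l1 l2 linear_maps_closed[OF l2])+
  finally show ?thesis ..
qed

text \<open>Contraction with \<phi> of the multiplicativity of \<Delta>, where the product of
  \<open>tensor_algebra\<close> unfolds to a double sum.\<close>

lemma sw_mult:
  assumes [lin]: "module K P" "x \<in> carrier H" "y \<in> carrier H"
    and l1: "\<And>y. y \<in> carrier H \<Longrightarrow> (\<lambda>x. \<phi> x y) \<in> linear_maps K H P"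
    and l2: "\<And>x. x \<in> carrier H \<Longrightarrow> (\<lambda>y. \<phi> x y) \<in> linear_maps K H P"
  shows "sw P \<phi> (x \<otimes>\<^bsub>H\<^esub> y) =
    sw P (\<lambda>a b. sw P (\<lambda>c d. \<phi> (a \<otimes>\<^bsub>H\<^esub> c) (b \<otimes>\<^bsub>H\<^esub> d)) y) x"
proof -
  let ?T = "tensor_module K H H"
  have lift: "tensor_lift K H H P \<phi> \<in> linear_maps K ?T P"
    by (rule tensor_lift_linear[where f = "\<lambda>x. x"]) (assumption | rule lin l1 l2)+
  have "sw P \<phi> (x \<otimes>\<^bsub>H\<^esub> y) = tensor_lift K H H P \<phi>
      (sw ?T (\<lambda>a b. sw ?T (\<lambda>c d. pure_tensor K H H (a \<otimes>\<^bsub>H\<^esub> c) (b \<otimes>\<^bsub>H\<^esub> d)) y) x)"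
    using comult_mult[OF assms(2,3)] by (simp add: tensor_algebra_def Let_def)
  also have "\<dots> = sw P (\<lambda>a b. tensor_lift K H H P \<phi>
      (sw ?T (\<lambda>c d. pure_tensor K H H (a \<otimes>\<^bsub>H\<^esub> c) (b \<otimes>\<^bsub>H\<^esub> d)) y)) x"
    by (rule sw_linear[OF lift]) (assumption | rule lin)+
  also have "\<dots> = sw P (\<lambda>a b. sw P (\<lambda>c d. tensor_lift K H H P \<phi>
      (pure_tensor K H H (a \<otimes>\<^bsub>H\<^esub> c) (b \<otimes>\<^bsub>H\<^esub> d))) y) x"
    by (rule sw_cong, rule_tac [3] sw_linear[OF lift])
      (assumption | rule lin l1 l2 linear_maps_closed[OF lift])+
  also have "\<dots> = sw P (\<lambda>a b. sw P (\<lambda>c d. \<phi> (a \<otimes>\<^bsub>H\<^esub> c) (b \<otimes>\<^bsub>H\<^esub> d)) y) x"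
    by (assumption | rule sw_cong tensor_lift_pure lin l1 l2 linear_maps_closed[OF l2])+
  finally show ?thesis .
qed

lemma sw_one:
  assumes [lin]: "module K P"
    and l1: "\<And>y. y \<in> carrier H \<Longrightarrow> (\<lambda>x. \<phi> x y) \<in> linear_maps K H P"
    and l2: "\<And>x. x \<in> carrier H \<Longrightarrow> (\<lambda>y. \<phi> x y) \<in> linear_maps K H P"
  shows "sw P \<phi> \<one>\<^bsub>H\<^esub> = \<phi> \<one>\<^bsub>H\<^esub> \<one>\<^bsub>H\<^esub>"
proof -
  have "sw P \<phi> \<one>\<^bsub>H\<^esub> = tensor_lift K H H P \<phi> (pure_tensor K H H \<one>\<^bsub>H\<^esub> \<one>\<^bsub>H\<^esub>)"
    using comult_one by (simp add: tensor_algebra_def Let_def)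
  also have "\<dots> = \<phi> \<one>\<^bsub>H\<^esub> \<one>\<^bsub>H\<^esub>"
    by (rule tensor_lift_pure) (assumption | rule lin l1 l2)+
  finally show ?thesis .
qed

text \<open>The axioms for counit and antipode with a linear map \<open>f\<close> around them, which
  is the form in which they apply deep inside an expression.\<close>

lemma
  assumes f: "f \<in> linear_maps K H P" and [lin]: "module K P" "x \<in> carrier H"
  shows sw_counit_left: "sw P (\<lambda>a b. \<epsilon> a \<odot>\<^bsub>P\<^esub> f b) x = f x"
    and sw_counit_right: "sw P (\<lambda>a b. \<epsilon> b \<odot>\<^bsub>P\<^esub> f a) x = f x"
    and sw_antipode_left: "sw P (\<lambda>a b. f (S a \<otimes>\<^bsub>H\<^esub> b)) x = \<epsilon> x \<odot>\<^bsub>P\<^esub> f \<one>\<^bsub>H\<^esub>"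
    and sw_antipode_right: "sw P (\<lambda>a b. f (a \<otimes>\<^bsub>H\<^esub> S b)) x = \<epsilon> x \<odot>\<^bsub>P\<^esub> f \<one>\<^bsub>H\<^esub>"
proof -
  note x = assms(3)
  have "f (sw H (\<lambda>a b. \<epsilon> a \<odot>\<^bsub>H\<^esub> b) x) = sw P (\<lambda>a b. f (\<epsilon> a \<odot>\<^bsub>H\<^esub> b)) x"
    by (rule sw_linear[OF f]) (assumption | rule lin)+
  also have "\<dots> = sw P (\<lambda>a b. \<epsilon> a \<odot>\<^bsub>P\<^esub> f b) x"
    by (assumption | rule sw_cong lin linear_maps_smult[OF f] linear_maps_closed[OF f])+
  finally show "sw P (\<lambda>a b. \<epsilon> a \<odot>\<^bsub>P\<^esub> f b) x = f x" by (simp add: counit_left[OF x])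
  have "f (sw H (\<lambda>a b. \<epsilon> b \<odot>\<^bsub>H\<^esub> a) x) = sw P (\<lambda>a b. f (\<epsilon> b \<odot>\<^bsub>H\<^esub> a)) x"
    by (rule sw_linear[OF f]) (assumption | rule lin)+
  also have "\<dots> = sw P (\<lambda>a b. \<epsilon> b \<odot>\<^bsub>P\<^esub> f a) x"
    by (assumption | rule sw_cong lin linear_maps_smult[OF f] linear_maps_closed[OF f])+
  finally show "sw P (\<lambda>a b. \<epsilon> b \<odot>\<^bsub>P\<^esub> f a) x = f x" by (simp add: counit_right[OF x])
  have "f (sw H (\<lambda>a b. S a \<otimes>\<^bsub>H\<^esub> b) x) = sw P (\<lambda>a b. f (S a \<otimes>\<^bsub>H\<^esub> b)) x"
    by (rule sw_linear[OF f]) (assumption | rule lin)+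
  thus "sw P (\<lambda>a b. f (S a \<otimes>\<^bsub>H\<^esub> b)) x = \<epsilon> x \<odot>\<^bsub>P\<^esub> f \<one>\<^bsub>H\<^esub>"
    by (simp add: antipode_left[OF x] linear_maps_smult[OF f] counit_closed x)
  have "f (sw H (\<lambda>a b. a \<otimes>\<^bsub>H\<^esub> S b) x) = sw P (\<lambda>a b. f (a \<otimes>\<^bsub>H\<^esub> S b)) x"
    by (rule sw_linear[OF f]) (assumption | rule lin)+
  thus "sw P (\<lambda>a b. f (a \<otimes>\<^bsub>H\<^esub> S b)) x = \<epsilon> x \<odot>\<^bsub>P\<^esub> f \<one>\<^bsub>H\<^esub>"
    by (simp add: antipode_right[OF x] linear_maps_smult[OF f] counit_closed x)
qed

text \<open>Rebracketing lets the first two of three components stem from the same comultiplication,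
  cocommutativity exchanges them, and a second rebracketing restores the form.\<close>

lemma sw_middle_swap:
  assumes [lin]: "module K P" "x \<in> carrier H"
    and l1: "\<And>y z. \<lbrakk>y \<in> carrier H; z \<in> carrier H\<rbrakk> \<Longrightarrow> (\<lambda>x. \<phi> x y z) \<in> linear_maps K H P"
    and l2: "\<And>x z. \<lbrakk>x \<in> carrier H; z \<in> carrier H\<rbrakk> \<Longrightarrow> (\<lambda>y. \<phi> x y z) \<in> linear_maps K H P"
    and l3: "\<And>x y. \<lbrakk>x \<in> carrier H; y \<in> carrier H\<rbrakk> \<Longrightarrow> (\<lambda>z. \<phi> x y z) \<in> linear_maps K H P"
  shows "sw P (\<lambda>a b. sw P (\<lambda>c d. \<phi> c a d) b) x = sw P (\<lambda>a b. sw P (\<lambda>c d. \<phi> a c d) b) x"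
proof -
  note [lin] = linear_maps_compose[OF l1] linear_maps_compose[OF l2] linear_maps_compose[OF l3]
    linear_maps_closed[OF l3]
  have "sw P (\<lambda>a b. sw P (\<lambda>c d. \<phi> c a d) b) x = sw P (\<lambda>a b. sw P (\<lambda>c d. \<phi> d c b) a) x"
    by (rule sw_coassoc[symmetric]) (assumption | rule lin)+
  also have "\<dots> = sw P (\<lambda>a b. sw P (\<lambda>c d. \<phi> c d b) a) x"
    by (rule sw_cong, rule_tac [3] sw_cocomm) (assumption | rule lin)+
  also have "\<dots> = sw P (\<lambda>a b. sw P (\<lambda>c d. \<phi> a c d) b) x"
    by (rule sw_coassoc) (assumption | rule lin)+
  finally show ?thesis .
qed

text \<open>Of four components the second and third change places: the first is split off by
  coassociativity and \<open>sw_middle_swap\<close> acts on the rest. In other words, \<Delta> is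
  itself a coalgebra map.\<close>

lemma sw_interchange:
  assumes [lin]: "module K P" "x \<in> carrier H"
    and l1: "\<And>b c d. \<lbrakk>b \<in> carrier H; c \<in> carrier H; d \<in> carrier H\<rbrakk> \<Longrightarrow>
      (\<lambda>a. \<phi> a b c d) \<in> linear_maps K H P"
    and l2: "\<And>a c d. \<lbrakk>a \<in> carrier H; c \<in> carrier H; d \<in> carrier H\<rbrakk> \<Longrightarrow>
      (\<lambda>b. \<phi> a b c d) \<in> linear_maps K H P"
    and l3: "\<And>a b d. \<lbrakk>a \<in> carrier H; b \<in> carrier H; d \<in> carrier H\<rbrakk> \<Longrightarrow>
      (\<lambda>c. \<phi> a b c d) \<in> linear_maps K H P"
    and l4: "\<And>a b c. \<lbrakk>a \<in> carrier H; b \<in> carrier H; c \<in> carrier H\<rbrakk> \<Longrightarrow>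
      (\<lambda>d. \<phi> a b c d) \<in> linear_maps K H P"
  shows "sw P (\<lambda>p q. sw P (\<lambda>a b. sw P (\<lambda>c d. \<phi> a b c d) q) p) x =
    sw P (\<lambda>p q. sw P (\<lambda>a b. sw P (\<lambda>c d. \<phi> a c b d) q) p) x"
proof -
  note [lin] = linear_maps_compose[OF l1] linear_maps_compose[OF l2] linear_maps_compose[OF l3]
    linear_maps_compose[OF l4] linear_maps_closed[OF l4]
  have "sw P (\<lambda>p q. sw P (\<lambda>a b. sw P (\<lambda>c d. \<phi> a b c d) q) p) x =
      sw P (\<lambda>a r. sw P (\<lambda>b q. sw P (\<lambda>c d. \<phi> a b c d) q) r) x"
    by (rule sw_coassoc) (assumption | rule lin)+
  also have "\<dots> = sw P (\<lambda>a r. sw P (\<lambda>b q. sw P (\<lambda>c d. \<phi> a c b d) q) r) x"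
    by (rule sw_cong, rule_tac [3] sw_middle_swap) (assumption | rule lin)+
  also have "\<dots> = sw P (\<lambda>p q. sw P (\<lambda>a b. sw P (\<lambda>c d. \<phi> a c b d) q) p) x"
    by (rule sw_coassoc[symmetric]) (assumption | rule lin)+
  finally show ?thesis .
qed

section \<open>The antipode: products, coproducts and cancellation\<close>

text \<open>Uniqueness of convolution inverses: both sides invert the multiplication map of
  \<open>H\<close>, one from each side. The convolution product of all three maps is evaluated in
  two ways.\<close>

lemma antipode_mult:
  assumes [lin]: "x \<in> carrier H" "y \<in> carrier H"
  shows "S (x \<otimes>\<^bsub>H\<^esub> y) = S y \<otimes>\<^bsub>H\<^esub> S x"
proof -
  \<comment> \<open>With three components of each element this is S(y1) S(x1) (x2 y2) S(x3
    y3).\<close>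
  let ?T = "sw H (\<lambda>x1 x2. sw H (\<lambda>y1 y2. sw H (\<lambda>a b. sw H (\<lambda>c d.
      S y1 \<otimes>\<^bsub>H\<^esub> S x1 \<otimes>\<^bsub>H\<^esub> ((a \<otimes>\<^bsub>H\<^esub> c) \<otimes>\<^bsub>H\<^esub> S (b \<otimes>\<^bsub>H\<^esub> d))) y2) x2) y) x"
  \<comment> \<open>The right-hand factors form the antipode axiom at the product u v, by
    \<open>sw_mult\<close> read backwards.\<close>
  have 1: "sw H (\<lambda>a b. sw H (\<lambda>c d. z \<otimes>\<^bsub>H\<^esub> ((a \<otimes>\<^bsub>H\<^esub> c) \<otimes>\<^bsub>H\<^esub> S (b \<otimes>\<^bsub>H\<^esub> d))) v) u =
      \<epsilon> u \<odot>\<^bsub>H\<^esub> (\<epsilon> v \<odot>\<^bsub>H\<^esub> z)"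
    if [lin]: "u \<in> carrier H" "v \<in> carrier H" "z \<in> carrier H" for u v z
  proof -
    have "sw H (\<lambda>a b. sw H (\<lambda>c d. z \<otimes>\<^bsub>H\<^esub> ((a \<otimes>\<^bsub>H\<^esub> c) \<otimes>\<^bsub>H\<^esub> S (b \<otimes>\<^bsub>H\<^esub> d))) v) u =
        sw H (\<lambda>a b. z \<otimes>\<^bsub>H\<^esub> (a \<otimes>\<^bsub>H\<^esub> S b)) (u \<otimes>\<^bsub>H\<^esub> v)"
      by (rule sw_mult[symmetric]) (assumption | rule lin)+
    also have "\<dots> = \<epsilon> (u \<otimes>\<^bsub>H\<^esub> v) \<odot>\<^bsub>H\<^esub> (z \<otimes>\<^bsub>H\<^esub> \<one>\<^bsub>H\<^esub>)"
      by (rule sw_antipode_right) (assumption | rule lin)+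
    also have "\<dots> = \<epsilon> u \<odot>\<^bsub>H\<^esub> (\<epsilon> v \<odot>\<^bsub>H\<^esub> z)"
      using that by (simp add: counit_mult smult_assoc1 counit_closed)
    finally show ?thesis .
  qed
  have "?T = sw H (\<lambda>x1 x2. sw H (\<lambda>y1 y2. \<epsilon> x2 \<odot>\<^bsub>H\<^esub> (\<epsilon> y2 \<odot>\<^bsub>H\<^esub> (S y1 \<otimes>\<^bsub>H\<^esub> S x1))) y) x"
    by (assumption | rule 1 sw_cong lin)+
  also have "\<dots> = sw H (\<lambda>x1 x2. \<epsilon> x2 \<odot>\<^bsub>H\<^esub> (sw H (\<lambda>y1 y2. \<epsilon> y2 \<odot>\<^bsub>H\<^esub> (S y1 \<otimes>\<^bsub>H\<^esub> S x1)) y)) x"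
    by (rule sw_cong, rule_tac [3] sw_linear[symmetric]) (assumption | rule lin)+
  also have "\<dots> = sw H (\<lambda>y1 y2. \<epsilon> y2 \<odot>\<^bsub>H\<^esub> (S y1 \<otimes>\<^bsub>H\<^esub> S x)) y"
    by (rule sw_counit_right) (assumption | rule lin)+
  also have "\<dots> = S y \<otimes>\<^bsub>H\<^esub> S x"
    by (rule sw_counit_right) (assumption | rule lin)+
  finally have A: "?T = S y \<otimes>\<^bsub>H\<^esub> S x" .
  \<comment> \<open>Second evaluation: the sums are regrouped until x1, x2 share one
    comultiplication and y1, y2 another, so that the left-hand factors can cancel.\<close>
  have "?T = sw H (\<lambda>x1 x2. sw H (\<lambda>a b. sw H (\<lambda>y1 y2. sw H (\<lambda>c d.
      S y1 \<otimes>\<^bsub>H\<^esub> S x1 \<otimes>\<^bsub>H\<^esub> ((a \<otimes>\<^bsub>H\<^esub> c) \<otimes>\<^bsub>H\<^esub> S (b \<otimes>\<^bsub>H\<^esub> d))) y2) y) x2) x"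
    by (rule sw_cong, rule_tac [3] sw_swap) (assumption | rule lin)+
  also have "\<dots> = sw H (\<lambda>p b. sw H (\<lambda>x1 a. sw H (\<lambda>y1 y2. sw H (\<lambda>c d.
      S y1 \<otimes>\<^bsub>H\<^esub> S x1 \<otimes>\<^bsub>H\<^esub> ((a \<otimes>\<^bsub>H\<^esub> c) \<otimes>\<^bsub>H\<^esub> S (b \<otimes>\<^bsub>H\<^esub> d))) y2) y) p) x"
    by (rule sw_coassoc[symmetric]) (assumption | rule lin)+
  also have "\<dots> = sw H (\<lambda>p b. sw H (\<lambda>x1 a. sw H (\<lambda>q d. sw H (\<lambda>y1 c.
      S y1 \<otimes>\<^bsub>H\<^esub> S x1 \<otimes>\<^bsub>H\<^esub> ((a \<otimes>\<^bsub>H\<^esub> c) \<otimes>\<^bsub>H\<^esub> S (b \<otimes>\<^bsub>H\<^esub> d))) q) y) p) x"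
    by (rule sw_cong, rule_tac [3] sw_cong, rule_tac [5] sw_coassoc[symmetric])
      (assumption | rule lin)+
  also have "\<dots> = sw H (\<lambda>p b. sw H (\<lambda>q d. sw H (\<lambda>x1 a. sw H (\<lambda>y1 c.
      S y1 \<otimes>\<^bsub>H\<^esub> S x1 \<otimes>\<^bsub>H\<^esub> ((a \<otimes>\<^bsub>H\<^esub> c) \<otimes>\<^bsub>H\<^esub> S (b \<otimes>\<^bsub>H\<^esub> d))) q) p) y) x"
    by (rule sw_cong, rule_tac [3] sw_swap) (assumption | rule lin)+
  also have "\<dots> = sw H (\<lambda>p b. sw H (\<lambda>q d. \<epsilon> q \<odot>\<^bsub>H\<^esub> (\<epsilon> p \<odot>\<^bsub>H\<^esub> S (b \<otimes>\<^bsub>H\<^esub> d))) y) x"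
  proof -
    \<comment> \<open>In S(y1) S(x1) x2 y2 the inner pair S(x1) x2 must go first, hence the sum over
      \<open>p\<close> is moved innermost; then S(y1) y2 collapses.\<close>
    have 2: "sw H (\<lambda>x1 a. sw H (\<lambda>y1 c.
        S y1 \<otimes>\<^bsub>H\<^esub> S x1 \<otimes>\<^bsub>H\<^esub> ((a \<otimes>\<^bsub>H\<^esub> c) \<otimes>\<^bsub>H\<^esub> z)) q) p = \<epsilon> q \<odot>\<^bsub>H\<^esub> (\<epsilon> p \<odot>\<^bsub>H\<^esub> z)"
      if [lin]: "p \<in> carrier H" "q \<in> carrier H" "z \<in> carrier H" for p q z
    proof -
      have "sw H (\<lambda>x1 a. sw H (\<lambda>y1 c. S y1 \<otimes>\<^bsub>H\<^esub> S x1 \<otimes>\<^bsub>H\<^esub> ((a \<otimes>\<^bsub>H\<^esub> c) \<otimes>\<^bsub>H\<^esub> z)) q) p =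
          sw H (\<lambda>y1 c. sw H (\<lambda>x1 a. S y1 \<otimes>\<^bsub>H\<^esub> S x1 \<otimes>\<^bsub>H\<^esub> ((a \<otimes>\<^bsub>H\<^esub> c) \<otimes>\<^bsub>H\<^esub> z)) p) q"
        by (rule sw_swap) (assumption | rule lin)+
      also have "\<dots> = sw H (\<lambda>y1 c. sw H (\<lambda>x1 a. S y1 \<otimes>\<^bsub>H\<^esub> ((S x1 \<otimes>\<^bsub>H\<^esub> a) \<otimes>\<^bsub>H\<^esub> (c \<otimes>\<^bsub>H\<^esub> z))) p) q"
        by (assumption | rule sw_cong lin | simp add: m_assoc antipode_closed that)+
      also have "\<dots> = sw H (\<lambda>y1 c. \<epsilon> p \<odot>\<^bsub>H\<^esub> (S y1 \<otimes>\<^bsub>H\<^esub> (\<one>\<^bsub>H\<^esub> \<otimes>\<^bsub>H\<^esub> (c \<otimes>\<^bsub>H\<^esub> z)))) q"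
        by (rule sw_cong, rule_tac [3] sw_antipode_left) (assumption | rule lin)+
      also have "\<dots> = sw H (\<lambda>y1 c. \<epsilon> p \<odot>\<^bsub>H\<^esub> ((S y1 \<otimes>\<^bsub>H\<^esub> c) \<otimes>\<^bsub>H\<^esub> z)) q"
        by (assumption | rule sw_cong lin | simp add: m_assoc antipode_closed that)+
      also have "\<dots> = \<epsilon> q \<odot>\<^bsub>H\<^esub> (\<epsilon> p \<odot>\<^bsub>H\<^esub> (\<one>\<^bsub>H\<^esub> \<otimes>\<^bsub>H\<^esub> z))"
        by (rule sw_antipode_left) (assumption | rule lin)+
      finally show ?thesis using that by simp
    qed
    show ?thesis by (assumption | rule 2 sw_cong lin)+
  qed
  also have "\<dots> = sw H (\<lambda>p b. \<epsilon> p \<odot>\<^bsub>H\<^esub> S (b \<otimes>\<^bsub>H\<^esub> y)) x"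
    by (rule sw_cong, rule_tac [3] sw_counit_left) (assumption | rule lin)+
  also have "\<dots> = S (x \<otimes>\<^bsub>H\<^esub> y)"
    by (rule sw_counit_left) (assumption | rule lin)+
  finally show ?thesis using A by simp
qed

text \<open>Both sides are the contraction of \<open>\<Delta> (S x\<^sup>(\<^sup>1\<^sup>)) \<Delta> (x\<^sup>(\<^sup>2\<^sup>)) (S x\<^sup>(\<^sup>3\<^sup>) \<otimes> S x\<^sup>(\<^sup>4\<^sup>))\<close>, which collapses either
  by \<open>S x\<^sup>(\<^sup>1\<^sup>) x\<^sup>(\<^sup>2\<^sup>) = \<epsilon> x\<close>, or, after an interchange, by \<open>x\<^sup>(\<^sup>1\<^sup>) S x\<^sup>(\<^sup>2\<^sup>) = \<epsilon> x\<close> in both tensor factors.\<close>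

lemma antipode_comult:
  assumes [lin]: "module K P" "x \<in> carrier H"
    and l1: "\<And>y. y \<in> carrier H \<Longrightarrow> (\<lambda>x. \<phi> x y) \<in> linear_maps K H P"
    and l2: "\<And>x. x \<in> carrier H \<Longrightarrow> (\<lambda>y. \<phi> x y) \<in> linear_maps K H P"
  shows "sw P \<phi> (S x) = sw P (\<lambda>a b. \<phi> (S a) (S b)) x"
proof -
  note [lin] = linear_maps_compose[OF l1] linear_maps_compose[OF l2] linear_maps_closed[OF l2]
  \<comment> \<open>\<open>?G q z\<close> is \<phi> applied to \<Delta>(z) (S(q1) tensor S(q2)); as
    a linear map in \<open>z\<close> it can play the part of \<open>f\<close> in
    \<open>sw_antipode_left\<close>.\<close>
  let ?G = "\<lambda>q. sw P (\<lambda>\<alpha> \<beta>. sw P (\<lambda>e f. \<phi> (\<alpha> \<otimes>\<^bsub>H\<^esub> S e) (\<beta> \<otimes>\<^bsub>H\<^esub> S f)) q)"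
  let ?E = "sw P (\<lambda>x1 r. sw P (\<lambda>p q. ?G q (S x1 \<otimes>\<^bsub>H\<^esub> p)) r) x"
  have "?E = sw P (\<lambda>s q. sw P (\<lambda>x1 p. ?G q (S x1 \<otimes>\<^bsub>H\<^esub> p)) s) x"
    by (rule sw_coassoc[symmetric]) (assumption | rule lin)+
  also have "\<dots> = sw P (\<lambda>s q. \<epsilon> s \<odot>\<^bsub>P\<^esub> ?G q \<one>\<^bsub>H\<^esub>) x"
    by (rule sw_cong, rule_tac [3] sw_antipode_left) (assumption | rule lin)+
  also have "\<dots> = ?G x \<one>\<^bsub>H\<^esub>"
    by (rule sw_counit_left) (assumption | rule lin)+
  also have "\<dots> = sw P (\<lambda>e f. \<phi> (\<one>\<^bsub>H\<^esub> \<otimes>\<^bsub>H\<^esub> S e) (\<one>\<^bsub>H\<^esub> \<otimes>\<^bsub>H\<^esub> S f)) x"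
    by (rule sw_one) (assumption | rule lin)+
  also have "\<dots> = sw P (\<lambda>e f. \<phi> (S e) (S f)) x"
    by (assumption | rule sw_cong lin | simp add: antipode_closed)+
  finally have "?E = sw P (\<lambda>e f. \<phi> (S e) (S f)) x" .
  moreover
  have collapse: "sw P (\<lambda>p q. sw P (\<lambda>c d. sw P (\<lambda>e f.
      \<phi> (a \<otimes>\<^bsub>H\<^esub> c \<otimes>\<^bsub>H\<^esub> S e) (b \<otimes>\<^bsub>H\<^esub> d \<otimes>\<^bsub>H\<^esub> S f)) q) p) r = \<epsilon> r \<odot>\<^bsub>P\<^esub> \<phi> a b"
    if [lin]: "a \<in> carrier H" "b \<in> carrier H" "r \<in> carrier H" for a b r
  proof -
    have "sw P (\<lambda>p q. sw P (\<lambda>c d. sw P (\<lambda>e f.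
        \<phi> (a \<otimes>\<^bsub>H\<^esub> c \<otimes>\<^bsub>H\<^esub> S e) (b \<otimes>\<^bsub>H\<^esub> d \<otimes>\<^bsub>H\<^esub> S f)) q) p) r =
      sw P (\<lambda>p q. sw P (\<lambda>c e. sw P (\<lambda>d f.
        \<phi> (a \<otimes>\<^bsub>H\<^esub> c \<otimes>\<^bsub>H\<^esub> S e) (b \<otimes>\<^bsub>H\<^esub> d \<otimes>\<^bsub>H\<^esub> S f)) q) p) r"
      by (rule sw_interchange) (assumption | rule lin)+
    also have "\<dots> = sw P (\<lambda>p q. sw P (\<lambda>c e. sw P (\<lambda>d f.
        \<phi> (a \<otimes>\<^bsub>H\<^esub> (c \<otimes>\<^bsub>H\<^esub> S e)) (b \<otimes>\<^bsub>H\<^esub> (d \<otimes>\<^bsub>H\<^esub> S f))) q) p) r"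
      by (assumption | rule sw_cong lin | simp add: antipode_closed m_assoc that)+
    also have "\<dots> = sw P (\<lambda>p q. sw P (\<lambda>c e. \<epsilon> q \<odot>\<^bsub>P\<^esub>
        \<phi> (a \<otimes>\<^bsub>H\<^esub> (c \<otimes>\<^bsub>H\<^esub> S e)) (b \<otimes>\<^bsub>H\<^esub> \<one>\<^bsub>H\<^esub>)) p) r"
      by (rule sw_cong, rule_tac [3] sw_cong, rule_tac [5] sw_antipode_right) (assumption | rule lin)+
    also have "\<dots> = sw P (\<lambda>p q. \<epsilon> p \<odot>\<^bsub>P\<^esub> (\<epsilon> q \<odot>\<^bsub>P\<^esub> \<phi> (a \<otimes>\<^bsub>H\<^esub> \<one>\<^bsub>H\<^esub>) (b \<otimes>\<^bsub>H\<^esub> \<one>\<^bsub>H\<^esub>))) r"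
      by (rule sw_cong, rule_tac [3] sw_antipode_right) (assumption | rule lin)+
    also have "\<dots> = \<epsilon> r \<odot>\<^bsub>P\<^esub> \<phi> (a \<otimes>\<^bsub>H\<^esub> \<one>\<^bsub>H\<^esub>) (b \<otimes>\<^bsub>H\<^esub> \<one>\<^bsub>H\<^esub>)"
      by (rule sw_counit_left) (assumption | rule lin)+
    finally show ?thesis using that by simp
  qed
  \<comment> \<open>Second evaluation: multiplicativity splits \<Delta>(S(x1) p) into the components
    a, b of S(x1) and c, d of p.\<close>
  have "?E = sw P (\<lambda>x1 r. sw P (\<lambda>p q. sw P (\<lambda>a b. sw P (\<lambda>c d. sw P (\<lambda>e f.
      \<phi> (a \<otimes>\<^bsub>H\<^esub> c \<otimes>\<^bsub>H\<^esub> S e) (b \<otimes>\<^bsub>H\<^esub> d \<otimes>\<^bsub>H\<^esub> S f)) q) p) (S x1)) r) x"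
    by (rule sw_cong, rule_tac [3] sw_cong, rule_tac [5] sw_mult) (assumption | rule lin)+
  also have "\<dots> = sw P (\<lambda>x1 r. sw P (\<lambda>a b. sw P (\<lambda>p q. sw P (\<lambda>c d. sw P (\<lambda>e f.
      \<phi> (a \<otimes>\<^bsub>H\<^esub> c \<otimes>\<^bsub>H\<^esub> S e) (b \<otimes>\<^bsub>H\<^esub> d \<otimes>\<^bsub>H\<^esub> S f)) q) p) r) (S x1)) x"
    by (rule sw_cong, rule_tac [3] sw_swap) (assumption | rule lin)+
  also have "\<dots> = sw P (\<lambda>x1 r. sw P (\<lambda>a b. \<epsilon> r \<odot>\<^bsub>P\<^esub> \<phi> a b) (S x1)) x"
    by (assumption | rule collapse sw_cong lin)+
  also have "\<dots> = sw P (\<lambda>x1 r. \<epsilon> r \<odot>\<^bsub>P\<^esub> sw P \<phi> (S x1)) x"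
    by (rule sw_cong, rule_tac [3] sw_linear[symmetric]) (assumption | rule lin)+
  also have "\<dots> = sw P \<phi> (S x)"
    by (rule sw_counit_right) (assumption | rule lin)+
  ultimately show ?thesis by simp
qed

text \<open>In components the left side is \<phi> at x2, x1 S(x3), x4. Exchanging x1 and x2 makes
  the factors of the product adjacent, so the antipode axiom turns it into the unit and the counit
  absorbs the remaining scalar.\<close>

lemma sw_cancel:
  assumes [lin]: "module K P" "x \<in> carrier H"
    and l1: "\<And>y z. \<lbrakk>y \<in> carrier H; z \<in> carrier H\<rbrakk> \<Longrightarrow> (\<lambda>x. \<phi> x y z) \<in> linear_maps K H P"
    and l2: "\<And>x z. \<lbrakk>x \<in> carrier H; z \<in> carrier H\<rbrakk> \<Longrightarrow> (\<lambda>y. \<phi> x y z) \<in> linear_maps K H P"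
    and l3: "\<And>x y. \<lbrakk>x \<in> carrier H; y \<in> carrier H\<rbrakk> \<Longrightarrow> (\<lambda>z. \<phi> x y z) \<in> linear_maps K H P"
  shows "sw P (\<lambda>a b. sw P (\<lambda>c d. sw P (\<lambda>e f. \<phi> c (a \<otimes>\<^bsub>H\<^esub> S e) f) d) b) x =
    sw P (\<lambda>a b. \<phi> a \<one>\<^bsub>H\<^esub> b) x"
proof -
  note [lin] = linear_maps_compose[OF l1] linear_maps_compose[OF l2] linear_maps_compose[OF l3]
    linear_maps_closed[OF l3]
  have "sw P (\<lambda>a b. sw P (\<lambda>c d. sw P (\<lambda>e f. \<phi> c (a \<otimes>\<^bsub>H\<^esub> S e) f) d) b) x =
      sw P (\<lambda>a b. sw P (\<lambda>c d. sw P (\<lambda>e f. \<phi> a (c \<otimes>\<^bsub>H\<^esub> S e) f) d) b) x"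
    by (rule sw_middle_swap) (assumption | rule lin)+
  also have "\<dots> = sw P (\<lambda>a b. sw P (\<lambda>s f. sw P (\<lambda>c e. \<phi> a (c \<otimes>\<^bsub>H\<^esub> S e) f) s) b) x"
    by (rule sw_cong, rule_tac [3] sw_coassoc[symmetric]) (assumption | rule lin)+
  also have "\<dots> = sw P (\<lambda>a b. sw P (\<lambda>s f. \<epsilon> s \<odot>\<^bsub>P\<^esub> \<phi> a \<one>\<^bsub>H\<^esub> f) b) x"
    by (rule sw_cong, rule_tac [3] sw_cong, rule_tac [5] sw_antipode_right) (assumption | rule lin)+
  also have "\<dots> = sw P (\<lambda>a b. \<phi> a \<one>\<^bsub>H\<^esub> b) x"
    by (rule sw_cong, rule_tac [3] sw_counit_left) (assumption | rule lin)+
  finally show ?thesis .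
qed

section \<open>The coalgebra \<open>X\<close>, the action of \<open>H\<close> on it and the map
  \<open>\<nu>\<close>\<close>

abbreviation "X \<equiv> tensor_module K H H"
abbreviation "XX \<equiv> tensor_module K X X"
abbreviation "\<Delta>\<^sub>X \<equiv> tensor_comult K H \<Delta> H \<Delta>"
abbreviation swX where "swX P \<phi> w \<equiv> tensor_lift K X X P \<phi> (\<Delta>\<^sub>X w)"
abbreviation tens (infixr "\<diamondop>" 75) where "x \<diamondop> y \<equiv> pure_tensor K H H x y"

text \<open>Constants rather than abbreviations, so that the closure rules can recognize them as
  outermost operations.\<close>

definition act where "act u g = u \<otimes>\<^bsub>tensor_algebra K H H\<^esub> \<Delta> g"
definition \<nu> where "\<nu> = tensor_lift K H H H (\<lambda>x y. S x \<otimes>\<^bsub>H\<^esub> y)"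

lemma comult_X_linear: "\<Delta>\<^sub>X \<in> linear_maps K X XX"
  unfolding tensor_comult_def Let_def
  by (rule tensor_lift_linear[where f = "\<lambda>x. x"]) (assumption | rule lin)+

lemma comult_X_closed [lin]: "u \<in> carrier X \<Longrightarrow> \<Delta>\<^sub>X u \<in> carrier XX"
  by (rule linear_maps_closed[OF comult_X_linear])

lemma act_eq:
  "act u g = tensor_lift K H H X (\<lambda>a b. sw X (\<lambda>c d. (a \<otimes>\<^bsub>H\<^esub> c) \<diamondop> (b \<otimes>\<^bsub>H\<^esub> d)) g) u"
  by (simp add: act_def tensor_algebra_def Let_def)

lemma act_linear_left [lin]:
  "\<lbrakk>g \<in> carrier H; f \<in> linear_maps K L X\<rbrakk> \<Longrightarrow> (\<lambda>u. act (f u) g) \<in> linear_maps K L X"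
  unfolding act_eq by (rule tensor_lift_linear) (assumption | rule lin)+

lemma act_linear_right [lin]:
  "\<lbrakk>module K L; u \<in> carrier X; f \<in> linear_maps K L H\<rbrakk> \<Longrightarrow> (\<lambda>g. act u (f g)) \<in> linear_maps K L X"
  unfolding act_eq by (rule tensor_lift_linear_param) (assumption | rule lin)+

lemma act_closed [lin]: "\<lbrakk>u \<in> carrier X; g \<in> carrier H\<rbrakk> \<Longrightarrow> act u g \<in> carrier X"
  unfolding act_eq by (assumption | rule lin)+

lemma nu_linear: "\<nu> \<in> linear_maps K X H"
  unfolding \<nu>_def by (rule tensor_lift_linear[where f = "\<lambda>x. x"]) (assumption | rule lin)+

lemma nu_closed [lin]: "u \<in> carrier X \<Longrightarrow> \<nu> u \<in> carrier H"
  by (rule linear_maps_closed[OF nu_linear])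

lemmas [lin] = linear_maps_compose[OF comult_X_linear] linear_maps_compose[OF nu_linear]

lemma act_pure:
  "\<lbrakk>a \<in> carrier H; b \<in> carrier H; g \<in> carrier H\<rbrakk> \<Longrightarrow>
    act (a \<diamondop> b) g = sw X (\<lambda>c d. (a \<otimes>\<^bsub>H\<^esub> c) \<diamondop> (b \<otimes>\<^bsub>H\<^esub> d)) g"
  unfolding act_eq by (rule tensor_lift_pure) (assumption | rule lin)+

lemma nu_pure: "\<lbrakk>a \<in> carrier H; b \<in> carrier H\<rbrakk> \<Longrightarrow> \<nu> (a \<diamondop> b) = S a \<otimes>\<^bsub>H\<^esub> b"
  unfolding \<nu>_def by (rule tensor_lift_pure) (assumption | rule lin)+

lemma swX_cong:
  "\<lbrakk>module K P; u \<in> carrier X;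
    \<And>a b. \<lbrakk>a \<in> carrier X; b \<in> carrier X\<rbrakk> \<Longrightarrow> \<phi> a b = \<psi> a b;
    \<And>a b. \<lbrakk>a \<in> carrier X; b \<in> carrier X\<rbrakk> \<Longrightarrow> \<psi> a b \<in> carrier P\<rbrakk> \<Longrightarrow> swX P \<phi> u = swX P \<psi> u"
  by (rule tensor_lift_cong) (assumption | rule lin)+

lemma swX_linear:
  "\<lbrakk>f \<in> linear_maps K P Q; module K P; module K Q; u \<in> carrier X;
    \<And>a b. \<lbrakk>a \<in> carrier X; b \<in> carrier X\<rbrakk> \<Longrightarrow> \<phi> a b \<in> carrier P\<rbrakk> \<Longrightarrow>
    f (swX P \<phi> u) = swX Q (\<lambda>a b. f (\<phi> a b)) u"
  by (rule linear_maps_tensor_lift) (assumption | rule lin)+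

text \<open>Reduces sums over \<open>X\<close> to sums over \<open>H\<close>. Identities on
  \<open>X\<close> are then checked on pure tensors and extended by
  \<open>linear_maps_tensor_eqI\<close>.\<close>

lemma swX_pure:
  assumes [lin]: "module K P" "x \<in> carrier H" "y \<in> carrier H"
    and l1: "\<And>y. y \<in> carrier X \<Longrightarrow> (\<lambda>x. \<phi> x y) \<in> linear_maps K X P"
    and l2: "\<And>x. x \<in> carrier X \<Longrightarrow> (\<lambda>y. \<phi> x y) \<in> linear_maps K X P"
  shows "swX P \<phi> (x \<diamondop> y) = sw P (\<lambda>x1 x2. sw P (\<lambda>y1 y2. \<phi> (x1 \<diamondop> y1) (x2 \<diamondop> y2)) y) x"
proof -
  note [lin] = linear_maps_compose[OF l1] linear_maps_compose[OF l2] linear_maps_closed[OF l2]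
  have lift: "tensor_lift K X X P \<phi> \<in> linear_maps K XX P"
    by (rule tensor_lift_linear[where f = "\<lambda>x. x"]) (assumption | rule lin)+
  have "\<Delta>\<^sub>X (x \<diamondop> y) =
      sw XX (\<lambda>x1 x2. sw XX (\<lambda>y1 y2. pure_tensor K X X (x1 \<diamondop> y1) (x2 \<diamondop> y2)) y) x"
    unfolding tensor_comult_def Let_def
    by (rule tensor_lift_pure) (assumption | rule lin)+
  hence "swX P \<phi> (x \<diamondop> y) = tensor_lift K X X P \<phi>
      (sw XX (\<lambda>x1 x2. sw XX (\<lambda>y1 y2. pure_tensor K X X (x1 \<diamondop> y1) (x2 \<diamondop> y2)) y) x)"
    by simp
  also have "\<dots> = sw P (\<lambda>x1 x2. tensor_lift K X X P \<phi>
      (sw XX (\<lambda>y1 y2. pure_tensor K X X (x1 \<diamondop> y1) (x2 \<diamondop> y2)) y)) x"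
    by (rule sw_linear[OF lift]) (assumption | rule lin)+
  also have "\<dots> = sw P (\<lambda>x1 x2. sw P (\<lambda>y1 y2. tensor_lift K X X P \<phi>
      (pure_tensor K X X (x1 \<diamondop> y1) (x2 \<diamondop> y2))) y) x"
    by (rule sw_cong, rule_tac [3] sw_linear[OF lift]) (assumption | rule lin)+
  also have "\<dots> = sw P (\<lambda>x1 x2. sw P (\<lambda>y1 y2. \<phi> (x1 \<diamondop> y1) (x2 \<diamondop> y2)) y) x"
    by (assumption | rule sw_cong tensor_lift_pure lin)+
  finally show ?thesis .
qed

text \<open>On a pure tensor the sums over x and y are independent: they are disentangled by
  \<open>sw_swap\<close>, rebracketed separately and interleaved again.\<close>

lemma swX_coassoc:
  assumes [lin]: "module K P" "u \<in> carrier X"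
    and l1: "\<And>y z. \<lbrakk>y \<in> carrier X; z \<in> carrier X\<rbrakk> \<Longrightarrow> (\<lambda>x. \<phi> x y z) \<in> linear_maps K X P"
    and l2: "\<And>x z. \<lbrakk>x \<in> carrier X; z \<in> carrier X\<rbrakk> \<Longrightarrow> (\<lambda>y. \<phi> x y z) \<in> linear_maps K X P"
    and l3: "\<And>x y. \<lbrakk>x \<in> carrier X; y \<in> carrier X\<rbrakk> \<Longrightarrow> (\<lambda>z. \<phi> x y z) \<in> linear_maps K X P"
  shows "swX P (\<lambda>a b. swX P (\<lambda>c d. \<phi> c d b) a) u = swX P (\<lambda>a b. swX P (\<lambda>c d. \<phi> a c d) b) u"
proof -
  note [lin] = linear_maps_compose[OF l1] linear_maps_compose[OF l2] linear_maps_compose[OF l3]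
    linear_maps_closed[OF l3]
  have pure: "swX P (\<lambda>a b. swX P (\<lambda>c d. \<phi> c d b) a) (x \<diamondop> y) =
      swX P (\<lambda>a b. swX P (\<lambda>c d. \<phi> a c d) b) (x \<diamondop> y)"
    if [lin]: "x \<in> carrier H" "y \<in> carrier H" for x y
  proof -
    have "swX P (\<lambda>a b. swX P (\<lambda>c d. \<phi> c d b) a) (x \<diamondop> y) =
        sw P (\<lambda>p c. sw P (\<lambda>q c'. swX P (\<lambda>a b. \<phi> a b (c \<diamondop> c')) (p \<diamondop> q)) y) x"
      by (rule swX_pure) (assumption | rule lin)+
    also have "\<dots> = sw P (\<lambda>p c. sw P (\<lambda>q c'. sw P (\<lambda>a b. sw P (\<lambda>a' b'.
        \<phi> (a \<diamondop> a') (b \<diamondop> b') (c \<diamondop> c')) q) p) y) x"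
      by (rule sw_cong, rule_tac [3] sw_cong, rule_tac [5] swX_pure) (assumption | rule lin)+
    also have "\<dots> = sw P (\<lambda>p c. sw P (\<lambda>a b. sw P (\<lambda>q c'. sw P (\<lambda>a' b'.
        \<phi> (a \<diamondop> a') (b \<diamondop> b') (c \<diamondop> c')) q) y) p) x"
      by (rule sw_cong, rule_tac [3] sw_swap) (assumption | rule lin)+
    also have "\<dots> = sw P (\<lambda>a p. sw P (\<lambda>b c. sw P (\<lambda>q c'. sw P (\<lambda>a' b'.
        \<phi> (a \<diamondop> a') (b \<diamondop> b') (c \<diamondop> c')) q) y) p) x"
      by (rule sw_coassoc) (assumption | rule lin)+
    also have "\<dots> = sw P (\<lambda>a p. sw P (\<lambda>b c. sw P (\<lambda>a' q. sw P (\<lambda>b' c'.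
        \<phi> (a \<diamondop> a') (b \<diamondop> b') (c \<diamondop> c')) q) y) p) x"
      by (rule sw_cong, rule_tac [3] sw_cong, rule_tac [5] sw_coassoc) (assumption | rule lin)+
    also have "\<dots> = sw P (\<lambda>a p. sw P (\<lambda>a' q. sw P (\<lambda>b c. sw P (\<lambda>b' c'.
        \<phi> (a \<diamondop> a') (b \<diamondop> b') (c \<diamondop> c')) q) p) y) x"
      by (rule sw_cong, rule_tac [3] sw_swap) (assumption | rule lin)+
    also have "\<dots> = sw P (\<lambda>a p. sw P (\<lambda>a' q. swX P (\<lambda>b c. \<phi> (a \<diamondop> a') b c) (p \<diamondop> q)) y) x"
      by (rule sw_cong, rule_tac [3] sw_cong, rule_tac [5] swX_pure[symmetric])
        (assumption | rule lin)+
    also have "\<dots> = swX P (\<lambda>a b. swX P (\<lambda>c d. \<phi> a c d) b) (x \<diamondop> y)"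
      by (rule swX_pure[symmetric]) (assumption | rule lin)+
    finally show ?thesis .
  qed
  show ?thesis
    by (rule linear_maps_tensor_eqI[of "\<lambda>u. swX P (\<lambda>a b. swX P (\<lambda>c d. \<phi> c d b) a) u" K H H P
          "\<lambda>u. swX P (\<lambda>a b. swX P (\<lambda>c d. \<phi> a c d) b) u"])
      (assumption | rule lin pure)+
qed

text \<open>Associativity of the action comes from multiplicativity of \<Delta> together with
  associativity in \<open>H\<close>.\<close>

lemma act_mult:
  assumes [lin]: "u \<in> carrier X" "g \<in> carrier H" "h \<in> carrier H"
  shows "act (act u g) h = act u (g \<otimes>\<^bsub>H\<^esub> h)"
proof -
  have pure: "act (act (a \<diamondop> b) g) h = act (a \<diamondop> b) (g \<otimes>\<^bsub>H\<^esub> h)"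
    if [lin]: "a \<in> carrier H" "b \<in> carrier H" for a b
  proof -
    have "act (act (a \<diamondop> b) g) h = act (sw X (\<lambda>c d. (a \<otimes>\<^bsub>H\<^esub> c) \<diamondop> (b \<otimes>\<^bsub>H\<^esub> d)) g) h"
      using assms that by (simp add: act_pure)
    also have "\<dots> = sw X (\<lambda>c d. act ((a \<otimes>\<^bsub>H\<^esub> c) \<diamondop> (b \<otimes>\<^bsub>H\<^esub> d)) h) g"
      by (rule sw_linear[where f = "\<lambda>u. act u h"]) (assumption | rule lin)+
    also have "\<dots> = sw X (\<lambda>c d. sw X (\<lambda>e f. (a \<otimes>\<^bsub>H\<^esub> c \<otimes>\<^bsub>H\<^esub> e) \<diamondop> (b \<otimes>\<^bsub>H\<^esub> d \<otimes>\<^bsub>H\<^esub> f)) h) g"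
      by (assumption | rule sw_cong act_pure lin)+
    also have "\<dots> = sw X (\<lambda>c d. sw X (\<lambda>e f. (a \<otimes>\<^bsub>H\<^esub> (c \<otimes>\<^bsub>H\<^esub> e)) \<diamondop> (b \<otimes>\<^bsub>H\<^esub> (d \<otimes>\<^bsub>H\<^esub> f))) h) g"
      by (assumption | rule sw_cong lin | simp add: m_assoc that)+
    also have "\<dots> = sw X (\<lambda>c d. (a \<otimes>\<^bsub>H\<^esub> c) \<diamondop> (b \<otimes>\<^bsub>H\<^esub> d)) (g \<otimes>\<^bsub>H\<^esub> h)"
      by (rule sw_mult[symmetric]) (assumption | rule lin)+
    also have "\<dots> = act (a \<diamondop> b) (g \<otimes>\<^bsub>H\<^esub> h)"
      by (rule act_pure[symmetric]) (assumption | rule lin)+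
    finally show ?thesis .
  qed
  show ?thesis
    by (rule linear_maps_tensor_eqI[of "\<lambda>u. act (act u g) h" K H H X "\<lambda>u. act u (g \<otimes>\<^bsub>H\<^esub> h)"])
      (assumption | rule lin pure)+
qed

text \<open>The action is a coalgebra map. Multiplicativity of \<Delta> expands both tensor factors,
  and cocommutativity puts the four components of \<open>g\<close> in the order required.\<close>

lemma swX_act:
  assumes [lin]: "module K P" "u \<in> carrier X" "g \<in> carrier H"
    and l1: "\<And>y. y \<in> carrier X \<Longrightarrow> (\<lambda>x. \<phi> x y) \<in> linear_maps K X P"
    and l2: "\<And>x. x \<in> carrier X \<Longrightarrow> (\<lambda>y. \<phi> x y) \<in> linear_maps K X P"
  shows "swX P \<phi> (act u g) = swX P (\<lambda>a b. sw P (\<lambda>c d. \<phi> (act a c) (act b d)) g) u"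
proof -
  note [lin] = linear_maps_compose[OF l1] linear_maps_compose[OF l2] linear_maps_closed[OF l2]
  have pure: "swX P \<phi> (act (x \<diamondop> y) g) =
      swX P (\<lambda>a b. sw P (\<lambda>c d. \<phi> (act a c) (act b d)) g) (x \<diamondop> y)"
    if [lin]: "x \<in> carrier H" "y \<in> carrier H" for x y
  proof -
    let ?t = "\<lambda>x1 x2 y1 y2 c1 c2 d1 d2.
      \<phi> ((x1 \<otimes>\<^bsub>H\<^esub> c1) \<diamondop> (y1 \<otimes>\<^bsub>H\<^esub> d1)) ((x2 \<otimes>\<^bsub>H\<^esub> c2) \<diamondop> (y2 \<otimes>\<^bsub>H\<^esub> d2))"
    have "swX P \<phi> (act (x \<diamondop> y) g) = swX P \<phi> (sw X (\<lambda>c d. (x \<otimes>\<^bsub>H\<^esub> c) \<diamondop> (y \<otimes>\<^bsub>H\<^esub> d)) g)"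
      using assms that by (simp add: act_pure)
    also have "\<dots> = sw P (\<lambda>c d. swX P \<phi> ((x \<otimes>\<^bsub>H\<^esub> c) \<diamondop> (y \<otimes>\<^bsub>H\<^esub> d))) g"
      by (rule sw_linear[where f = "\<lambda>u. swX P \<phi> u"]) (assumption | rule lin)+
    also have "\<dots> = sw P (\<lambda>c d. sw P (\<lambda>p q. sw P (\<lambda>r s. \<phi> (p \<diamondop> r) (q \<diamondop> s)) (y \<otimes>\<^bsub>H\<^esub> d)) (x \<otimes>\<^bsub>H\<^esub> c)) g"
      by (rule sw_cong, rule_tac [3] swX_pure) (assumption | rule lin)+
    also have "\<dots> = sw P (\<lambda>c d. sw P (\<lambda>x1 x2. sw P (\<lambda>c1 c2. sw P (\<lambda>r s.
        \<phi> ((x1 \<otimes>\<^bsub>H\<^esub> c1) \<diamondop> r) ((x2 \<otimes>\<^bsub>H\<^esub> c2) \<diamondop> s)) (y \<otimes>\<^bsub>H\<^esub> d)) c) x) g"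
      by (rule sw_cong, rule_tac [3] sw_mult) (assumption | rule lin)+
    also have "\<dots> = sw P (\<lambda>c d. sw P (\<lambda>x1 x2. sw P (\<lambda>c1 c2. sw P (\<lambda>y1 y2. sw P (\<lambda>d1 d2.
        ?t x1 x2 y1 y2 c1 c2 d1 d2) d) y) c) x) g"
      by (rule sw_cong, rule_tac [3] sw_cong, rule_tac [5] sw_cong, rule_tac [7] sw_mult)
        (assumption | rule lin)+
    also have "\<dots> = sw P (\<lambda>x1 x2. sw P (\<lambda>c d. sw P (\<lambda>c1 c2. sw P (\<lambda>y1 y2. sw P (\<lambda>d1 d2.
        ?t x1 x2 y1 y2 c1 c2 d1 d2) d) y) c) g) x"
      by (rule sw_swap) (assumption | rule lin)+
    also have "\<dots> = sw P (\<lambda>x1 x2. sw P (\<lambda>c d. sw P (\<lambda>y1 y2. sw P (\<lambda>c1 c2. sw P (\<lambda>d1 d2.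
        ?t x1 x2 y1 y2 c1 c2 d1 d2) d) c) y) g) x"
      by (rule sw_cong, rule_tac [3] sw_cong, rule_tac [5] sw_swap) (assumption | rule lin)+
    also have "\<dots> = sw P (\<lambda>x1 x2. sw P (\<lambda>y1 y2. sw P (\<lambda>c d. sw P (\<lambda>c1 c2. sw P (\<lambda>d1 d2.
        ?t x1 x2 y1 y2 c1 c2 d1 d2) d) c) g) y) x"
      by (rule sw_cong, rule_tac [3] sw_swap) (assumption | rule lin)+
    \<comment> \<open>Cocommutativity enters here: each of the two actions needs one component from
      \<open>c\<close> and one from \<open>d\<close>, and \<open>sw_interchange\<close> lets such
      pairs share a comultiplication.\<close>
    also have "\<dots> = sw P (\<lambda>x1 x2. sw P (\<lambda>y1 y2. sw P (\<lambda>c d. sw P (\<lambda>c1 d1. sw P (\<lambda>c2 d2.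
        ?t x1 x2 y1 y2 c1 c2 d1 d2) d) c) g) y) x"
      by (rule sw_cong, rule_tac [3] sw_cong, rule_tac [5] sw_interchange)
        (assumption | rule lin)+
    also have "\<dots> = sw P (\<lambda>x1 x2. sw P (\<lambda>y1 y2. sw P (\<lambda>c d. sw P (\<lambda>c1 d1.
        \<phi> ((x1 \<otimes>\<^bsub>H\<^esub> c1) \<diamondop> (y1 \<otimes>\<^bsub>H\<^esub> d1)) (act (x2 \<diamondop> y2) d)) c) g) y) x"
    proof -
      have 1: "sw P (\<lambda>c2 d2. \<phi> z ((x2 \<otimes>\<^bsub>H\<^esub> c2) \<diamondop> (y2 \<otimes>\<^bsub>H\<^esub> d2))) d = \<phi> z (act (x2 \<diamondop> y2) d)"
        if [lin]: "z \<in> carrier X" "x2 \<in> carrier H" "y2 \<in> carrier H" "d \<in> carrier H" for z x2 y2 d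
        unfolding act_pure[OF that(2-4)]
        by (rule sw_linear[where f = "\<lambda>u. \<phi> z u", symmetric]) (assumption | rule lin)+
      show ?thesis by (assumption | rule 1 sw_cong lin)+
    qed
    also have "\<dots> = sw P (\<lambda>x1 x2. sw P (\<lambda>y1 y2. sw P (\<lambda>c d.
        \<phi> (act (x1 \<diamondop> y1) c) (act (x2 \<diamondop> y2) d)) g) y) x"
    proof -
      have 1: "sw P (\<lambda>c2 d2. \<phi> ((x2 \<otimes>\<^bsub>H\<^esub> c2) \<diamondop> (y2 \<otimes>\<^bsub>H\<^esub> d2)) z) d = \<phi> (act (x2 \<diamondop> y2) d) z"
        if [lin]: "z \<in> carrier X" "x2 \<in> carrier H" "y2 \<in> carrier H" "d \<in> carrier H" for z x2 y2 d
        unfolding act_pure[OF that(2-4)]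
        by (rule sw_linear[where f = "\<lambda>u. \<phi> u z", symmetric]) (assumption | rule lin)+
      show ?thesis by (assumption | rule 1 sw_cong lin)+
    qed
    also have "\<dots> = swX P (\<lambda>a b. sw P (\<lambda>c d. \<phi> (act a c) (act b d)) g) (x \<diamondop> y)"
      by (rule swX_pure[symmetric]) (assumption | rule lin)+
    finally show ?thesis .
  qed
  show ?thesis
    by (rule linear_maps_tensor_eqI[of "\<lambda>u. swX P \<phi> (act u g)" K H H P
          "\<lambda>u. swX P (\<lambda>a b. sw P (\<lambda>c d. \<phi> (act a c) (act b d)) g) u"])
      (assumption | rule lin pure)+
qed

text \<open>\<open>\<nu>\<close> is a coalgebra map because the product of \<open>H\<close> is one
  and, by \<open>antipode_comult\<close>, so is \<open>S\<close>.\<close>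

lemma sw_nu:
  assumes [lin]: "module K P" "u \<in> carrier X"
    and l1: "\<And>y. y \<in> carrier H \<Longrightarrow> (\<lambda>x. \<phi> x y) \<in> linear_maps K H P"
    and l2: "\<And>x. x \<in> carrier H \<Longrightarrow> (\<lambda>y. \<phi> x y) \<in> linear_maps K H P"
  shows "sw P \<phi> (\<nu> u) = swX P (\<lambda>a b. \<phi> (\<nu> a) (\<nu> b)) u"
proof -
  note [lin] = linear_maps_compose[OF l1] linear_maps_compose[OF l2] linear_maps_closed[OF l2]
  have pure: "sw P \<phi> (\<nu> (x \<diamondop> y)) = swX P (\<lambda>a b. \<phi> (\<nu> a) (\<nu> b)) (x \<diamondop> y)"
    if [lin]: "x \<in> carrier H" "y \<in> carrier H" for x y
  proof -
    have "sw P \<phi> (\<nu> (x \<diamondop> y)) = sw P \<phi> (S x \<otimes>\<^bsub>H\<^esub> y)"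
      using that by (simp add: nu_pure)
    also have "\<dots> = sw P (\<lambda>a b. sw P (\<lambda>c d. \<phi> (a \<otimes>\<^bsub>H\<^esub> c) (b \<otimes>\<^bsub>H\<^esub> d)) y) (S x)"
      by (rule sw_mult) (assumption | rule lin)+
    also have "\<dots> = sw P (\<lambda>a b. sw P (\<lambda>c d. \<phi> (S a \<otimes>\<^bsub>H\<^esub> c) (S b \<otimes>\<^bsub>H\<^esub> d)) y) x"
      by (rule antipode_comult) (assumption | rule lin)+
    also have "\<dots> = sw P (\<lambda>a b. sw P (\<lambda>c d. \<phi> (\<nu> (a \<diamondop> c)) (\<nu> (b \<diamondop> d))) y) x"
      by (assumption | rule sw_cong lin | simp add: nu_pure)+
    also have "\<dots> = swX P (\<lambda>a b. \<phi> (\<nu> a) (\<nu> b)) (x \<diamondop> y)"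
      by (rule swX_pure[symmetric]) (assumption | rule lin)+
    finally show ?thesis .
  qed
  show ?thesis
    by (rule linear_maps_tensor_eqI[of "\<lambda>u. sw P \<phi> (\<nu> u)" K H H P
          "\<lambda>u. swX P (\<lambda>a b. \<phi> (\<nu> a) (\<nu> b)) u"])
      (assumption | rule lin pure)+
qed

text \<open>On pure tensors S(x g1) y g2 = S(g1) S(x) y g2 by \<open>antipode_mult\<close>.\<close>

lemma nu_act:
  assumes [lin]: "u \<in> carrier X" "g \<in> carrier H"
  shows "\<nu> (act u g) = sw H (\<lambda>a b. S a \<otimes>\<^bsub>H\<^esub> (\<nu> u \<otimes>\<^bsub>H\<^esub> b)) g"
proof -
  have pure: "\<nu> (act (x \<diamondop> y) g) = sw H (\<lambda>a b. S a \<otimes>\<^bsub>H\<^esub> (\<nu> (x \<diamondop> y) \<otimes>\<^bsub>H\<^esub> b)) g"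
    if [lin]: "x \<in> carrier H" "y \<in> carrier H" for x y
  proof -
    have "\<nu> (act (x \<diamondop> y) g) = \<nu> (sw X (\<lambda>c d. (x \<otimes>\<^bsub>H\<^esub> c) \<diamondop> (y \<otimes>\<^bsub>H\<^esub> d)) g)"
      using assms that by (simp add: act_pure)
    also have "\<dots> = sw H (\<lambda>c d. \<nu> ((x \<otimes>\<^bsub>H\<^esub> c) \<diamondop> (y \<otimes>\<^bsub>H\<^esub> d))) g"
      by (rule sw_linear[OF nu_linear]) (assumption | rule lin)+
    also have "\<dots> = sw H (\<lambda>a b. S a \<otimes>\<^bsub>H\<^esub> (\<nu> (x \<diamondop> y) \<otimes>\<^bsub>H\<^esub> b)) g"
      by (assumption | rule sw_cong lin
          | simp add: nu_pure antipode_mult antipode_closed m_assoc that)+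
    finally show ?thesis .
  qed
  show ?thesis
    by (rule linear_maps_tensor_eqI[of "\<lambda>u. \<nu> (act u g)" K H H H
          "\<lambda>u. sw H (\<lambda>a b. S a \<otimes>\<^bsub>H\<^esub> (\<nu> u \<otimes>\<^bsub>H\<^esub> b)) g"])
      (assumption | rule lin pure)+
qed

section \<open>The R-matrix on triple tensors\<close>

abbreviation "Y \<equiv> tensor_module K XX X"
abbreviation triple ("\<langle>_, _, _\<rangle>") where
  "\<langle>u, v, w\<rangle> \<equiv> pure_tensor K XX X (pure_tensor K X X u v) w"

definition R where "R = R_matrix K X \<Delta>\<^sub>X act \<nu>"
text \<open>This and \<open>R_right\<close> name the local \<open>R_I\<close> and \<open>I_R\<close>
  of \<open>yang_baxter_solution\<close>, so that closure rules can be stated for them.\<close>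

definition R_left where "R_left = tensor_map K XX X XX X R id"
definition R_right where
  "R_right = tensor_unassoc K X X X \<circ> tensor_map K X XX X XX id R \<circ> tensor_assoc K X X X"

lemma R_linear: "R \<in> linear_maps K XX XX"
  unfolding R_def R_matrix_def Let_def
  by (rule tensor_lift_linear[where f = "\<lambda>x. x"]) (assumption | rule lin)+

lemma R_closed [lin]: "t \<in> carrier XX \<Longrightarrow> R t \<in> carrier XX"
  by (rule linear_maps_closed[OF R_linear])

lemmas [lin] = linear_maps_compose[OF R_linear]

lemma R_pure:
  "\<lbrakk>u \<in> carrier X; v \<in> carrier X\<rbrakk> \<Longrightarrow>
    R (pure_tensor K X X u v) = swX XX (\<lambda>a b. pure_tensor K X X a (act u (\<nu> b))) v"
  unfolding R_def R_matrix_def Let_def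
  by (rule tensor_lift_pure) (assumption | rule lin)+

lemma R_left_linear: "R_left \<in> linear_maps K Y Y"
  unfolding R_left_def tensor_map_def id_def
  by (rule tensor_lift_linear[where f = "\<lambda>x. x"]) (assumption | rule lin)+

lemma R_right_linear: "R_right \<in> linear_maps K Y Y"
  unfolding R_right_def tensor_map_def tensor_unassoc_def tensor_assoc_def id_def Let_def comp_def
  by (assumption | rule lin)+

lemmas [lin] = linear_maps_compose[OF R_left_linear] linear_maps_compose[OF R_right_linear]
  linear_maps_closed[OF R_left_linear] linear_maps_closed[OF R_right_linear]

lemma R_left_triple:
  assumes [lin]: "u \<in> carrier X" "v \<in> carrier X" "w \<in> carrier X"
  shows "R_left \<langle>u, v, w\<rangle> = swX Y (\<lambda>a b. \<langle>a, act u (\<nu> b), w\<rangle>) v"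
proof -
  have "R_left \<langle>u, v, w\<rangle> = pure_tensor K XX X (R (pure_tensor K X X u v)) w"
    unfolding R_left_def tensor_map_def id_def
    by (rule tensor_lift_pure) (assumption | rule lin)+
  also have "\<dots> = swX Y (\<lambda>a b. \<langle>a, act u (\<nu> b), w\<rangle>) v"
    unfolding R_pure[OF assms(1,2)]
    by (rule swX_linear[where f = "\<lambda>t. pure_tensor K XX X t w"]) (assumption | rule lin)+
  finally show ?thesis .
qed

text \<open>The associativity maps only move brackets on pure triples; between them \<open>R\<close>
  acts on the last two entries.\<close>

lemma R_right_triple:
  assumes [lin]: "u \<in> carrier X" "v \<in> carrier X" "w \<in> carrier X"
  shows "R_right \<langle>u, v, w\<rangle> = swX Y (\<lambda>a b. \<langle>u, a, act v (\<nu> b)\<rangle>) w"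
proof -
  let ?Z = "tensor_module K X XX"
  have "tensor_assoc K X X X \<langle>u, v, w\<rangle> =
      tensor_lift K X X ?Z (\<lambda>x y. pure_tensor K X XX x (pure_tensor K X X y w)) (pure_tensor K X X u v)"
    unfolding tensor_assoc_def Let_def by (rule tensor_lift_pure) (assumption | rule lin)+
  also have "\<dots> = pure_tensor K X XX u (pure_tensor K X X v w)"
    by (rule tensor_lift_pure) (assumption | rule lin)+
  finally have assoc: "tensor_assoc K X X X \<langle>u, v, w\<rangle> = pure_tensor K X XX u (pure_tensor K X X v w)" .
  have map: "tensor_map K X XX X XX id R (pure_tensor K X XX u (pure_tensor K X X v w)) =
      pure_tensor K X XX u (R (pure_tensor K X X v w))"
    unfolding tensor_map_def id_def by (rule tensor_lift_pure) (assumption | rule lin)+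
  \<comment> \<open>The value of \<open>R\<close> is not a pure tensor in general, so only the outer
    lift is evaluated here; the inner one is pushed into the sum over \<open>w\<close>.\<close>
  have "tensor_unassoc K X X X (pure_tensor K X XX u (R (pure_tensor K X X v w))) =
      tensor_lift K X X Y (\<lambda>y z. \<langle>u, y, z\<rangle>) (R (pure_tensor K X X v w))"
    unfolding tensor_unassoc_def Let_def by (rule tensor_lift_pure) (assumption | rule lin)+
  also have "\<dots> = swX Y (\<lambda>a b. tensor_lift K X X Y (\<lambda>y z. \<langle>u, y, z\<rangle>)
      (pure_tensor K X X a (act v (\<nu> b)))) w"
    unfolding R_pure[OF assms(2,3)]
    by (rule swX_linear[where f = "tensor_lift K X X Y (\<lambda>y z. \<langle>u, y, z\<rangle>)"],
        rule tensor_lift_linear[where f = "\<lambda>x. x"]) (assumption | rule lin)+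
  also have "\<dots> = swX Y (\<lambda>a b. \<langle>u, a, act v (\<nu> b)\<rangle>) w"
    by (assumption | rule swX_cong tensor_lift_pure lin)+
  finally show ?thesis by (simp add: R_right_def assoc map)
qed

section \<open>Evaluation of both sides of the Yang-Baxter equation\<close>

lemma swX_swap:
  "\<lbrakk>module K P; u \<in> carrier X; v \<in> carrier X;
    \<And>a b c d. \<lbrakk>a \<in> carrier X; b \<in> carrier X; c \<in> carrier X; d \<in> carrier X\<rbrakk> \<Longrightarrow> \<phi> a b c d \<in> carrier P\<rbrakk> \<Longrightarrow>
    swX P (\<lambda>a b. swX P (\<lambda>c d. \<phi> a b c d) v) u = swX P (\<lambda>c d. swX P (\<lambda>a b. \<phi> a b c d) u) v"
  by (rule tensor_lift_swap) (assumption | rule lin two_modulesI)+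

lemma sw_swX_swap:
  "\<lbrakk>module K P; x \<in> carrier H; v \<in> carrier X;
    \<And>a b c d. \<lbrakk>a \<in> carrier H; b \<in> carrier H; c \<in> carrier X; d \<in> carrier X\<rbrakk> \<Longrightarrow> \<phi> a b c d \<in> carrier P\<rbrakk> \<Longrightarrow>
    sw P (\<lambda>a b. swX P (\<lambda>c d. \<phi> a b c d) v) x = swX P (\<lambda>c d. sw P (\<lambda>a b. \<phi> a b c d) x) v"
  by (rule tensor_lift_swap) (assumption | rule lin two_modulesI)+

text \<open>The right-hand side is the normal form to which both sides are brought: the sum over
  \<open>k\<close>, \<open>l\<close> runs over the components of one element
  \<open>\<nu> r\<close>.\<close>

lemma yang_baxter_left:
  assumes [lin]: "u \<in> carrier X" "v \<in> carrier X" "w \<in> carrier X"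
  shows "R_left (R_right (R_left \<langle>u, v, w\<rangle>)) =
    swX Y (\<lambda>a b. swX Y (\<lambda>p r. sw Y (\<lambda>k l. \<langle>p, act a k, act (act u (\<nu> b)) l\<rangle>) (\<nu> r)) w) v"
proof -
  have "R_left (R_right (R_left \<langle>u, v, w\<rangle>)) =
      R_left (R_right (swX Y (\<lambda>a b. \<langle>a, act u (\<nu> b), w\<rangle>) v))"
    by (simp add: R_left_triple assms)
  also have "\<dots> = swX Y (\<lambda>a b. R_left (R_right \<langle>a, act u (\<nu> b), w\<rangle>)) v"
    by (rule swX_linear[where f = "\<lambda>t. R_left (R_right t)"]) (assumption | rule lin)+
  also have "\<dots> = swX Y (\<lambda>a b. R_left (swX Y (\<lambda>c d. \<langle>a, c, act (act u (\<nu> b)) (\<nu> d)\<rangle>) w)) v"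
    by (assumption | rule swX_cong lin arg_cong[where f = R_left] R_right_triple)+
  also have "\<dots> = swX Y (\<lambda>a b. swX Y (\<lambda>c d. R_left \<langle>a, c, act (act u (\<nu> b)) (\<nu> d)\<rangle>) w) v"
    by (rule swX_cong, rule_tac [3] swX_linear[OF R_left_linear]) (assumption | rule lin)+
  also have "\<dots> = swX Y (\<lambda>a b. swX Y (\<lambda>c d. swX Y (\<lambda>p q.
      \<langle>p, act a (\<nu> q), act (act u (\<nu> b)) (\<nu> d)\<rangle>) c) w) v"
    by (assumption | rule R_left_triple swX_cong lin)+
  also have "\<dots> = swX Y (\<lambda>a b. swX Y (\<lambda>p r. swX Y (\<lambda>q d.
      \<langle>p, act a (\<nu> q), act (act u (\<nu> b)) (\<nu> d)\<rangle>) r) w) v"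
    by (rule swX_cong, rule_tac [3] swX_coassoc) (assumption | rule lin)+
  \<comment> \<open>\<open>\<nu>\<close> of the two components of \<open>r\<close> is replaced by
    the two components of \<open>\<nu> r\<close>.\<close>
  also have "\<dots> = swX Y (\<lambda>a b. swX Y (\<lambda>p r. sw Y (\<lambda>k l.
      \<langle>p, act a k, act (act u (\<nu> b)) l\<rangle>) (\<nu> r)) w) v"
    by (rule swX_cong, rule_tac [3] swX_cong, rule_tac [5] sw_nu[symmetric])
      (assumption | rule lin)+
  finally show ?thesis .
qed

lemma yang_baxter_right:
  assumes [lin]: "u \<in> carrier X" "v \<in> carrier X" "w \<in> carrier X"
  shows "R_right (R_left (R_right \<langle>u, v, w\<rangle>)) =
    swX Y (\<lambda>a b. swX Y (\<lambda>p r. sw Y (\<lambda>k l. \<langle>p, act a k, act (act u (\<nu> b)) l\<rangle>) (\<nu> r)) w) v"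
proof -
  have "R_right (R_left (R_right \<langle>u, v, w\<rangle>)) =
      R_right (R_left (swX Y (\<lambda>c d. \<langle>u, c, act v (\<nu> d)\<rangle>) w))"
    by (simp add: R_right_triple assms)
  also have "\<dots> = swX Y (\<lambda>c d. R_right (R_left \<langle>u, c, act v (\<nu> d)\<rangle>)) w"
    by (rule swX_linear[where f = "\<lambda>t. R_right (R_left t)"]) (assumption | rule lin)+
  also have "\<dots> = swX Y (\<lambda>c d. R_right (swX Y (\<lambda>p q. \<langle>p, act u (\<nu> q), act v (\<nu> d)\<rangle>) c)) w"
    by (assumption | rule swX_cong lin arg_cong[where f = R_right] R_left_triple)+
  also have "\<dots> = swX Y (\<lambda>c d. swX Y (\<lambda>p q. R_right \<langle>p, act u (\<nu> q), act v (\<nu> d)\<rangle>) c) w"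
    by (rule swX_cong, rule_tac [3] swX_linear[OF R_right_linear]) (assumption | rule lin)+
  also have "\<dots> = swX Y (\<lambda>c d. swX Y (\<lambda>p q. swX Y (\<lambda>a b.
      \<langle>p, a, act (act u (\<nu> q)) (\<nu> b)\<rangle>) (act v (\<nu> d))) c) w"
    by (assumption | rule R_right_triple swX_cong lin)+
  also have "\<dots> = swX Y (\<lambda>p r. swX Y (\<lambda>q d. swX Y (\<lambda>a b.
      \<langle>p, a, act (act u (\<nu> q)) (\<nu> b)\<rangle>) (act v (\<nu> d))) r) w"
    by (rule swX_coassoc) (assumption | rule lin)+
  \<comment> \<open>From here on \<open>r\<close> enters only through \<open>\<nu> r\<close>, so
    that the remaining computation takes place in \<open>H\<close>.\<close>
  also have "\<dots> = swX Y (\<lambda>p r. sw Y (\<lambda>k l. swX Y (\<lambda>a b.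
      \<langle>p, a, act (act u k) (\<nu> b)\<rangle>) (act v l)) (\<nu> r)) w"
    by (rule swX_cong, rule_tac [3] sw_nu[symmetric]) (assumption | rule lin)+
  also have "\<dots> = swX Y (\<lambda>p r. sw Y (\<lambda>k l. swX Y (\<lambda>a b. sw Y (\<lambda>c d.
      \<langle>p, act a c, act (act u k) (\<nu> (act b d))\<rangle>) l) v) (\<nu> r)) w"
    by (rule swX_cong, rule_tac [3] sw_cong, rule_tac [5] swX_act) (assumption | rule lin)+
  also have "\<dots> = swX Y (\<lambda>p r. sw Y (\<lambda>k l. swX Y (\<lambda>a b. sw Y (\<lambda>c d. sw Y (\<lambda>e f.
      \<langle>p, act a c, act u ((k \<otimes>\<^bsub>H\<^esub> S e) \<otimes>\<^bsub>H\<^esub> (\<nu> b \<otimes>\<^bsub>H\<^esub> f))\<rangle>) d) l) v) (\<nu> r)) w"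
  proof -
    \<comment> \<open>\<open>nu_act\<close> expands the innermost argument, and
      \<open>act_mult\<close> merges the two successive actions on \<open>u\<close> into one,
      bringing \<open>k\<close> next to \<open>S e\<close>.\<close>
    have 1: "\<langle>p, a, act (act u k) (\<nu> (act b d))\<rangle> = sw Y (\<lambda>e f.
        \<langle>p, a, act u ((k \<otimes>\<^bsub>H\<^esub> S e) \<otimes>\<^bsub>H\<^esub> (\<nu> b \<otimes>\<^bsub>H\<^esub> f))\<rangle>) d"
      if [lin]: "p \<in> carrier X" "a \<in> carrier X" "b \<in> carrier X" "k \<in> carrier H" "d \<in> carrier H"
      for p a b k d
    proof -
      have "\<langle>p, a, act (act u k) (\<nu> (act b d))\<rangle> =
          \<langle>p, a, act (act u k) (sw H (\<lambda>e f. S e \<otimes>\<^bsub>H\<^esub> (\<nu> b \<otimes>\<^bsub>H\<^esub> f)) d)\<rangle>"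
        using that by (simp add: nu_act)
      also have "\<dots> = sw Y (\<lambda>e f. \<langle>p, a, act (act u k) (S e \<otimes>\<^bsub>H\<^esub> (\<nu> b \<otimes>\<^bsub>H\<^esub> f))\<rangle>) d"
        by (rule sw_linear[where f = "\<lambda>g. \<langle>p, a, act (act u k) g\<rangle>"]) (assumption | rule lin)+
      also have "\<dots> = sw Y (\<lambda>e f. \<langle>p, a, act u ((k \<otimes>\<^bsub>H\<^esub> S e) \<otimes>\<^bsub>H\<^esub> (\<nu> b \<otimes>\<^bsub>H\<^esub> f))\<rangle>) d"
        by (assumption | rule sw_cong lin
            | simp add: act_mult m_assoc antipode_closed nu_closed assms that)+
      finally show ?thesis .
    qed
    show ?thesis by (assumption | rule 1 swX_cong sw_cong lin)+
  qed
  \<comment> \<open>The sum over \<open>v\<close> is moved outside, so that \<open>k\<close>,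
    \<open>c\<close>, \<open>e\<close>, \<open>f\<close> become four consecutive components of
    \<open>\<nu> r\<close>, nested as \<open>sw_cancel\<close> expects.\<close>
  also have "\<dots> = swX Y (\<lambda>p r. swX Y (\<lambda>a b. sw Y (\<lambda>k l. sw Y (\<lambda>c d. sw Y (\<lambda>e f.
      \<langle>p, act a c, act u ((k \<otimes>\<^bsub>H\<^esub> S e) \<otimes>\<^bsub>H\<^esub> (\<nu> b \<otimes>\<^bsub>H\<^esub> f))\<rangle>) d) l) (\<nu> r)) v) w"
    by (rule swX_cong, rule_tac [3] sw_swX_swap) (assumption | rule lin)+
  also have "\<dots> = swX Y (\<lambda>p r. swX Y (\<lambda>a b. sw Y (\<lambda>k l.
      \<langle>p, act a k, act u (\<one>\<^bsub>H\<^esub> \<otimes>\<^bsub>H\<^esub> (\<nu> b \<otimes>\<^bsub>H\<^esub> l))\<rangle>) (\<nu> r)) v) w"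
    by (rule swX_cong, rule_tac [3] swX_cong, rule_tac [5] sw_cancel) (assumption | rule lin)+
  also have "\<dots> = swX Y (\<lambda>p r. swX Y (\<lambda>a b. sw Y (\<lambda>k l.
      \<langle>p, act a k, act (act u (\<nu> b)) l\<rangle>) (\<nu> r)) v) w"
    by (assumption | rule sw_cong swX_cong lin | simp add: act_mult nu_closed assms)+
  also have "\<dots> = swX Y (\<lambda>a b. swX Y (\<lambda>p r. sw Y (\<lambda>k l.
      \<langle>p, act a k, act (act u (\<nu> b)) l\<rangle>) (\<nu> r)) w) v"
    by (rule swX_swap) (assumption | rule lin)+
  finally show ?thesis .
qed

lemma yang_baxter_R: "yang_baxter_solution K X R"
proof -
  have "R_left (R_right (R_left t)) = R_right (R_left (R_right t))" if [lin]: "t \<in> carrier Y" for t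
  \<comment> \<open>Pure tensors are reached in two stages: first in the outer product of
    \<open>XX\<close> with \<open>X\<close>, then inside \<open>XX\<close>.\<close>
  proof (rule linear_maps_tensor_eqI[of "\<lambda>t. R_left (R_right (R_left t))" K XX X Y
        "\<lambda>t. R_right (R_left (R_right t))"])
    fix s w assume sw [lin]: "s \<in> carrier XX" "w \<in> carrier X"
    show "R_left (R_right (R_left (pure_tensor K XX X s w))) =
        R_right (R_left (R_right (pure_tensor K XX X s w)))"
      by (rule linear_maps_tensor_eqI[of
            "\<lambda>s. R_left (R_right (R_left (pure_tensor K XX X s w)))" K X X Y
            "\<lambda>s. R_right (R_left (R_right (pure_tensor K XX X s w)))"])
        (assumption | rule lin | simp add: yang_baxter_left yang_baxter_right sw)+
  qed (assumption | rule lin)+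
  thus ?thesis
    using R_linear unfolding yang_baxter_solution_def Let_def R_left_def R_right_def by blast
qed

end

theorem proposition4p2:
  fixes K :: "('k, 'm) ring_scheme" and H :: "('k, 'h, 'n) module_scheme"
    and \<Delta> :: "'h \<Rightarrow> ('h \<times> 'h \<Rightarrow> 'k) set" and \<epsilon> :: "'h \<Rightarrow> 'k" and S :: "'h \<Rightarrow> 'h"
  assumes "cocommutative_hopf_algebra K H \<Delta> \<epsilon> S"
  shows "let X = tensor_module K H H;
             \<Delta>\<^sub>X = tensor_comult K H \<Delta> H \<Delta>;
             \<nu> = tensor_lift K H H H (\<lambda>x y. S x \<otimes>\<^bsub>H\<^esub> y);
             act = (\<lambda>u g. u \<otimes>\<^bsub>tensor_algebra K H H\<^esub> \<Delta> g)
         in yang_baxter_solution K X (R_matrix K X \<Delta>\<^sub>X act \<nu>)"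
proof -
  interpret cocommutative_hopf_algebra K H \<Delta> \<epsilon> S by fact
  \<comment> \<open>The statement binds the action as a function, so the pointwise definition is
    first turned into an equation of functions.\<close>
  have "act = (\<lambda>u g. u \<otimes>\<^bsub>tensor_algebra K H H\<^esub> \<Delta> g)"
    by (simp add: act_def fun_eq_iff)
  thus ?thesis
    using yang_baxter_R unfolding R_def \<nu>_def Let_def by simp
qed

end
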